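(* Consider the linear minimization oracle $O(\Lambda)\coloneqq\arg\min_{\Sigma}\{\langle\Lambda,\Sigma\rangle:\Sigma\in\mathbb{B}\}$ for a given $\widehat\Sigma\succeq0$, where the distance function is the Gelbrich distance $\mathrm G$, i.e. $\mathbb{B}\coloneqq\{\Sigma\succeq0:\mathrm{G}(\Sigma,\widehat\Sigma)\le\varepsilon\}$. (i) (Closed-form description) For any symmetric $\Lambda$ and a non-negative scalar $\gamma$, define $$\Sigma^\star(\Lambda,\gamma)\coloneqq\gamma^2(\gamma I+\Lambda)^{-1}\,\widehat\Sigma\,(\gamma I+\Lambda)^{-1}.$$ Then $O(\Lambda)$ equates to $\Sigma^\star(\Lambda,\gamma^\star)$, where $\gamma^\star$ is the unique scalar solution to the concave optimization $$\max_{\gamma\ge0}\ \gamma\big(\langle I-\gamma(\gamma I+\Lambda)^{-1},\widehat\Sigma\rangle-\varepsilon^2\big)\quad\text{s.t.}\quad\lambda_{\max}(-\Lambda)<\gamma\le\tfrac1\varepsilon\|\Lambda\|_F\big(2\lambda_{\max}^{\frac12}(\widehat\Sigma)+\varepsilon\big).$$ (ii) (Lipschitz constant) The Lipschitz constant $\mathcal{L}\coloneqq\max_{\Sigma\in\mathbb{B}}\|\Sigma\|_F$ (with respect to $\|\cdot\|_F$) of the dual function $g(\Lambda)\coloneqq\min_{\Sigma\in\mathbb{B}}\langle\Lambda,\Sigma\rangle$ is bounded by $$\mathcal{L}\le\big(2\lambda_{\max}^{\frac12}(\widehat\Sigma)+\varepsilon\big)\varepsilon+\|\widehat\Sigma\|_F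 .$$
   Context: All matrices are real symmetric $n\times n$. $\widehat\Sigma$ is a given (empirical covariance) matrix and $\varepsilon$ is the radius of the ball $\mathbb{B}$. $\langle A,B\rangle=\operatorname{Tr}(A^\top B)$, $\|\cdot\|_F$ is the Frobenius norm, $\lambda_{\max}$ is the largest eigenvalue and $\lambda_{\max}^{1/2}$ its square root. The Gelbrich distance is $$\mathrm{G}(\Sigma,\widehat\Sigma)=\sqrt{\operatorname{Tr}\big(\Sigma+\widehat\Sigma-2(\widehat\Sigma^{\frac12}\Sigma\widehat\Sigma^{\frac12})^{\frac12}\big)} .$$ If the oracle problem has several optimizers, $O(\Lambda)$ denotes an arbitrary selection among them.
   Formalization: A maximizer γ* need not exist (Λ = 0 gives an empty feasible set), so (i) is proved whenever one exists, which holds iff λ_max(−Λ) < 0 or G(Σ*(Λ,γ), Σ̂) ≥ ε for some γ > λ_max(−Λ); the radius ε is taken positive. *)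

theory Defs
  imports "HOL-Analysis.Analysis"
begin

definition symm :: "real^'n^'n \<Rightarrow> bool" where
  "symm A \<longleftrightarrow> transpose A = A"

definition psd :: "real^'n^'n \<Rightarrow> bool" where
  "psd A \<longleftrightarrow> symm A \<and> (\<forall>x. 0 \<le> x \<bullet> (A *v x))"

definition frob_inner :: "real^'n^'n \<Rightarrow> real^'n^'n \<Rightarrow> real" where
  "frob_inner A B = trace (transpose A ** B)"

lemma frob_inner_eq_inner: "frob_inner A B = A \<bullet> B"
proof -
  have "frob_inner A B = (\<Sum>i\<in>UNIV. \<Sum>k\<in>UNIV. A $ k $ i * B $ k $ i)"
    by (simp add: frob_inner_def trace_def matrix_matrix_mult_def transpose_def)
  also have "\<dots> = (\<Sum>k\<in>UNIV. \<Sum>i\<in>UNIV. A $ k $ i * B $ k $ i)"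
    by (rule sum.swap)
  finally show ?thesis by (simp add: inner_vec_def)
qed

text \<open>The library norm on \<^typ>\<open>real^'n^'n\<close> is the Frobenius norm, and is used as such below.\<close>

lemma frob_norm: "norm (A :: real^'n^'n) = sqrt (frob_inner A A)"
  by (simp add: frob_inner_eq_inner norm_eq_sqrt_inner)

text \<open>Only meant for symmetric matrices, whose set of real eigenvalues is finite and nonempty.\<close>

definition lambda_max :: "real^'n^'n \<Rightarrow> real" where
  "lambda_max A = Max {k. \<exists>v. v \<noteq> 0 \<and> A *v v = k *\<^sub>R v}"

text \<open>The positive semidefinite square root; only meant for positive semidefinite arguments.\<close>

definition psd_sqrt :: "real^'n^'n \<Rightarrow> real^'n^'n" where
  "psd_sqrt A = (THE B. psd B \<and> B ** B = A)"

definition gelbrich :: "real^'n^'n \<Rightarrow> real^'n^'n \<Rightarrow> real" where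
  "gelbrich S T = sqrt (trace (S + T - 2 *\<^sub>R psd_sqrt (psd_sqrt T ** S ** psd_sqrt T)))"

definition gelbrich_ball :: "real^'n^'n \<Rightarrow> real \<Rightarrow> (real^'n^'n) set" where
  "gelbrich_ball T \<epsilon> = {S. psd S \<and> gelbrich S T \<le> \<epsilon>}"

text \<open>The set of all optimizers: a linear minimization oracle is a selection from it.\<close>

definition oracle_argmin :: "real^'n^'n \<Rightarrow> real \<Rightarrow> real^'n^'n \<Rightarrow> (real^'n^'n) set" where
  "oracle_argmin T \<epsilon> \<Lambda> = {S. is_arg_min (frob_inner \<Lambda>) (\<lambda>S. S \<in> gelbrich_ball T \<epsilon>) S}"

definition Sigma_star :: "real^'n^'n \<Rightarrow> real^'n^'n \<Rightarrow> real \<Rightarrow> real^'n^'n" where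
  "Sigma_star T \<Lambda> \<gamma> =
     \<gamma>\<^sup>2 *\<^sub>R (matrix_inv (\<gamma> *\<^sub>R mat 1 + \<Lambda>) ** T ** matrix_inv (\<gamma> *\<^sub>R mat 1 + \<Lambda>))"

definition gamma_objective :: "real^'n^'n \<Rightarrow> real \<Rightarrow> real^'n^'n \<Rightarrow> real \<Rightarrow> real" where
  "gamma_objective T \<epsilon> \<Lambda> \<gamma> =
     \<gamma> * (frob_inner (mat 1 - \<gamma> *\<^sub>R matrix_inv (\<gamma> *\<^sub>R mat 1 + \<Lambda>)) T - \<epsilon>\<^sup>2)"

definition gamma_feasible :: "real^'n^'n \<Rightarrow> real \<Rightarrow> real^'n^'n \<Rightarrow> real set" where
  "gamma_feasible T \<epsilon> \<Lambda> =
     {\<gamma>. 0 \<le> \<gamma> \<and> lambda_max (- \<Lambda>) < \<gamma> \<and>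
          \<gamma> \<le> 1 / \<epsilon> * norm \<Lambda> * (2 * sqrt (lambda_max T) + \<epsilon>)}"

text \<open>The feasible interval is open on the left and may be empty, so a maximizer need not exist: for
  \<open>\<Lambda> = 0\<close> the interval is empty, and for \<open>T = 0\<close> the objective is strictly decreasing.\<close>

definition gamma_solution :: "real^'n^'n \<Rightarrow> real \<Rightarrow> real^'n^'n \<Rightarrow> real \<Rightarrow> bool" where
  "gamma_solution T \<epsilon> \<Lambda> \<gamma> \<longleftrightarrow>
     is_arg_max (gamma_objective T \<epsilon> \<Lambda>) (\<lambda>\<gamma>. \<gamma> \<in> gamma_feasible T \<epsilon> \<Lambda>) \<gamma>"

definition dual_fun :: "real^'n^'n \<Rightarrow> real \<Rightarrow> real^'n^'n \<Rightarrow> real" where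
  "dual_fun T \<epsilon> \<Lambda> = (INF S\<in>gelbrich_ball T \<epsilon>. frob_inner \<Lambda> S)"

definition dual_lip :: "real^'n^'n \<Rightarrow> real \<Rightarrow> real" where
  "dual_lip T \<epsilon> = (SUP S\<in>gelbrich_ball T \<epsilon>. norm S)"

end

theory Submission
  imports Defs
begin

text \<open>The Gelbrich distance is a Euclidean distance between suitably rotated square roots:
  with \<open>Y = psd_sqrt T\<close>, \<open>gelbrich S T\<close> is the least value of \<open>norm (X - Y)\<close> over all \<open>X\<close> with
  \<open>X ** transpose X = S\<close>, and the least value is attained (\<open>gelbrich_gram_le\<close>,
  \<open>gelbrich_attained\<close>). The optimal \<open>X\<close> comes from the polar decomposition of
  \<open>psd_sqrt S ** Y\<close>, whose factors rest on the spectral theorem. So the Gelbrich ball is the image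
  of a Frobenius ball around \<open>Y\<close> under \<open>X \<mapsto> X ** transpose X\<close> (\<open>gelbrich_ball_eq\<close>). It is
  therefore compact, which gives all attained minima and maxima, and expanding
  \<open>(Y + E) ** transpose (Y + E)\<close> with \<open>norm E \<le> \<epsilon>\<close> gives the bound on the Lipschitz constant.

  Linear minimization over the ball becomes, in the variable \<open>X\<close>, the minimization of the quadratic
  form \<open>X \<bullet> (\<Lambda> ** X)\<close> over a Euclidean ball. With \<open>M = \<gamma> I + \<Lambda>\<close> positive definite,
  completing the square in the Lagrangian gives \<open>gamma_objective\<close> plus the square
  \<open>Z \<bullet> (M ** Z)\<close>, where \<open>Z = X - \<gamma> M\<^sup>-\<^sup>1 Y\<close> (\<open>lagrangian_identity\<close>). Hence, under
  complementary slackness, the only optimizer is the one with \<open>Z = 0\<close>, which is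
  \<open>Sigma_star T \<Lambda> \<gamma>\<close> (\<open>oracle_argmin_eqI\<close>).

  It remains to see that a solution \<open>\<gamma>\<close> of the scalar problem satisfies complementary slackness.
  In an eigenframe of \<open>\<Lambda>\<close> the objective is a sum of elementary fractions, with derivative
  \<open>(gelbrich (Sigma_star T \<Lambda> \<gamma>) T)\<^sup>2 - \<epsilon>\<^sup>2\<close> (\<open>objective_has_derivative\<close>). This derivative
  decreases in \<open>\<gamma>\<close>, so the objective is concave, and it is negative from the upper end of the
  feasible interval on (\<open>gelbrich_beyond_gamma_bound\<close>). So a maximizer is either \<open>0\<close> or an interior
  zero of the derivative, there is at most one, and there is one exactly if the derivative is
  somewhere nonnegative or the left end \<open>0\<close> is itself feasible.

  The dual function is the support function of the ball up to two changes of sign. The largest norm \<open>norm R\<close> in the ball is a Lipschitz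
  constant by the Cauchy-Schwarz inequality, and it is the least one because on the segment from
  \<open>0\<close> to \<open>- R\<close> the dual function falls by at least \<open>(norm R)\<^sup>2\<close>
  (\<open>support_lipschitz\<close>, \<open>max_norm_le_lipschitz\<close>).\<close>

section \<open>Orthonormal frames and the spectral theorem\<close>

lemma symm_inner: "symm A \<Longrightarrow> x \<bullet> (A *v y) = (A *v x) \<bullet> y"
  unfolding symm_def by (metis dot_lmul_matrix vector_transpose_matrix)

lemma symmI: assumes "\<And>x y. x \<bullet> (A *v y) = (A *v x) \<bullet> y" shows "symm A"
proof -
  have "transpose A *v x = A *v x" for x
  proof -
    have "(transpose A *v x) \<bullet> y = (A *v x) \<bullet> y" for y
      using assms[of x y] by (simp add: dot_lmul_matrix)
    then show ?thesis by (metis vector_eq_rdot)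
  qed
  then show ?thesis unfolding symm_def by (simp add: matrix_eq)
qed

definition orthonormal_on :: "'i set \<Rightarrow> ('i \<Rightarrow> 'a::real_inner) \<Rightarrow> bool" where
  "orthonormal_on I v \<longleftrightarrow> (\<forall>i\<in>I. \<forall>j\<in>I. v i \<bullet> v j = (if i = j then 1 else 0))"

lemma orthogonal_to_partial_frame:
  fixes v :: "'n::finite \<Rightarrow> real^'n"
  assumes "J \<noteq> UNIV"
  obtains x where "x \<noteq> 0" "\<And>j. j \<in> J \<Longrightarrow> v j \<bullet> x = 0"
proof -
  have "dim (v ` J) \<le> card (v ` J)" by (rule dim_le_card) (auto intro: span_base)
  also have "\<dots> \<le> card J" by (rule card_image_le) simp
  also have "\<dots> < CARD('n)" using assms by (intro psubset_card_mono) auto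
  finally have "dim (v ` J) < DIM(real^'n)" by simp
  from orthogonal_to_subspace_exists[OF this]
  obtain x where x: "x \<noteq> 0" "\<And>y. y \<in> span (v ` J) \<Longrightarrow> orthogonal x y" by blast
  show thesis
    by (rule that[OF x(1)]) (metis imageI inner_commute orthogonal_def span_base x(2))
qed

lemma orthonormal_on_insert:
  assumes "orthonormal_on J v" "norm x = 1" "\<And>j. j \<in> J \<Longrightarrow> v j \<bullet> x = 0" "k \<notin> J"
  shows "orthonormal_on (insert k J) (v(k := x))"
  using assms by (auto simp: orthonormal_on_def norm_eq_1 inner_commute)

text \<open>The missing vectors are added one at a time; fewer than \<open>CARD('n)\<close> vectors never span the
  space, so there is always a unit vector orthogonal to those present.\<close>

lemma orthonormal_extend:
  fixes u :: "'n::finite \<Rightarrow> real^'n"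
  assumes "orthonormal_on I u"
  obtains w where "orthonormal_on UNIV w" "\<And>i. i \<in> I \<Longrightarrow> w i = u i"
proof -
  have "\<exists>w. orthonormal_on (I \<union> F) w \<and> (\<forall>i\<in>I. w i = u i)" if "finite F" for F
    using that
  proof induction
    case empty
    then show ?case using assms by auto
  next
    case (insert k F)
    then obtain w where w: "orthonormal_on (I \<union> F) w" "\<forall>i\<in>I. w i = u i" by blast
    show ?case
    proof (cases "k \<in> I")
      case True
      then show ?thesis using w by (auto simp: insert_absorb)
    next
      case False
      then have k: "k \<notin> I \<union> F" using insert by auto
      then have "I \<union> F \<noteq> UNIV" by auto
      then obtain x where x: "x \<noteq> 0" "\<And>j. j \<in> I \<union> F \<Longrightarrow> w j \<bullet> x = 0"
        using orthogonal_to_partial_frame[of "I \<union> F" w] by blast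
      have "orthonormal_on (insert k (I \<union> F)) (w(k := x /\<^sub>R norm x))"
        using x k by (intro orthonormal_on_insert w) auto
      moreover have "\<forall>i\<in>I. (w(k := x /\<^sub>R norm x)) i = u i" using w k by auto
      ultimately show ?thesis by auto
    qed
  qed
  from this[of UNIV] show thesis using that by auto
qed

text \<open>A maximizer \<open>v\<close> of the quadratic form on the unit sphere of \<open>W\<close> is an eigenvector: the
  form \<open>c |x|\<^sup>2 - x \<bullet> A x\<close>, with \<open>c\<close> the maximum, is nonnegative on \<open>W\<close> and vanishes at
  \<open>v\<close>, so its derivative at \<open>v\<close> in the direction \<open>A v - c v\<close>, which lies in \<open>W\<close>, is zero. But this
  derivative is \<open>- 2 |A v - c v|\<^sup>2\<close>.\<close>

lemma eigenvector_in_invariant_subspace: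
  fixes A :: "real^'n^'n"
  assumes A: "symm A" and W: "subspace W" "\<And>x. x \<in> W \<Longrightarrow> A *v x \<in> W"
    and ne: "x0 \<in> W" "x0 \<noteq> 0"
  obtains v c where "v \<in> W" "norm v = 1" "A *v v = c *\<^sub>R v"
proof -
  let ?K = "sphere 0 1 \<inter> W"
  have "compact ?K" using closed_subspace[OF W(1)] by (simp add: compact_Int_closed)
  moreover have "x0 /\<^sub>R norm x0 \<in> ?K" using ne W(1) by (auto intro: subspace_scale)
  moreover have "continuous_on ?K (\<lambda>x. x \<bullet> (A *v x))"
    by (intro continuous_intros linear_continuous_on) auto
  ultimately obtain v where v: "v \<in> ?K" "\<And>y. y \<in> ?K \<Longrightarrow> y \<bullet> (A *v y) \<le> v \<bullet> (A *v v)"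
    using continuous_attains_sup[of ?K "\<lambda>x. x \<bullet> (A *v x)"] by blast
  define c where "c = v \<bullet> (A *v v)"
  have v1: "v \<bullet> v = 1" using v(1) by (simp add: norm_eq_1)
  have le: "y \<bullet> (A *v y) \<le> c * (y \<bullet> y)" if "y \<in> W" for y
  proof (cases "y = 0")
    case False
    define z where "z = y /\<^sub>R norm y"
    have "z \<in> ?K" using False that W(1) unfolding z_def by (auto intro: subspace_scale)
    then have "z \<bullet> (A *v z) \<le> c" using v(2) c_def by blast
    moreover have "y = norm y *\<^sub>R z" using False by (simp add: z_def)
    then have "y \<bullet> (A *v y) = norm y * (norm y * (z \<bullet> (A *v z)))"
      by (metis inner_scaleR_left inner_scaleR_right matrix_vector_mult_scaleR)
    moreover have "y \<bullet> y = norm y * norm y" by (simp add: norm_eq_sqrt_inner)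
    moreover have "norm y * (norm y * (z \<bullet> (A *v z))) \<le> norm y * (norm y * c)"
      using calculation(1) by (intro mult_left_mono) auto
    ultimately show ?thesis by (simp add: mult.commute mult.left_commute)
  qed simp
  define w where "w = A *v v - c *\<^sub>R v"
  have wW: "w \<in> W" unfolding w_def using v(1) W by (auto intro: subspace_diff subspace_scale)
  have vw: "v \<bullet> (A *v w) = w \<bullet> (A *v v)" using symm_inner[OF A] by (metis inner_commute)
  have dir: "w \<bullet> (A *v v) - c * (v \<bullet> w) = w \<bullet> w"
    unfolding w_def by (simp add: inner_diff_left inner_diff_right inner_commute algebra_simps v1 flip: c_def)
  have "w \<bullet> w = 0"
  proof (rule ccontr)
    assume nz: "w \<bullet> w \<noteq> 0"
    define q where "q = c * (w \<bullet> w) - w \<bullet> (A *v w)"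
    have q: "2 * t * (w \<bullet> w) \<le> t\<^sup>2 * q" for t
    proof -
      have "v + t *\<^sub>R w \<in> W" using v(1) wW W(1) by (auto intro: subspace_add subspace_scale)
      from le[OF this] have "c + 2 * t * (w \<bullet> (A *v v)) + t\<^sup>2 * (w \<bullet> (A *v w))
          \<le> c * (1 + 2 * t * (v \<bullet> w) + t\<^sup>2 * (w \<bullet> w))"
        by (simp add: algebra_simps inner_add_left inner_add_right v1 vw c_def[symmetric]
            power2_eq_square inner_commute[of w v])
      then have "2 * t * (w \<bullet> (A *v v) - c * (v \<bullet> w)) \<le> t\<^sup>2 * q"
        by (simp add: q_def algebra_simps)
      then show ?thesis by (simp add: dir)
    qed
    have pos: "w \<bullet> w > 0" using nz inner_ge_zero[of w] by linarith
    \<comment> \<open>The bound by \<open>t\<^sup>2 * q\<close> fails for small \<open>t > 0\<close>, and this \<open>t\<close> is small enough.\<close>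
    define t where "t = (w \<bullet> w) / (\<bar>q\<bar> + 1)"
    have t: "t > 0" using pos by (simp add: t_def add_nonneg_pos)
    have "2 * (w \<bullet> w) \<le> t * q" using q[of t] t by (simp add: power2_eq_square)
    also have "\<dots> \<le> t * (\<bar>q\<bar> + 1)" using t by (intro mult_left_mono) auto
    also have "\<dots> = w \<bullet> w" by (simp add: t_def)
    finally show False using pos by simp
  qed
  then have "A *v v = c *\<^sub>R v" by (simp add: w_def)
  then show thesis using that v(1) by auto
qed

definition eigenframe :: "real^'n^'n \<Rightarrow> ('n \<Rightarrow> real^'n) \<Rightarrow> ('n \<Rightarrow> real) \<Rightarrow> bool" where
  "eigenframe A v l \<longleftrightarrow> orthonormal_on UNIV v \<and> (\<forall>i. A *v v i = l i *\<^sub>R v i)"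

lemma eigenframeD:
  assumes "eigenframe A v l"
  shows "orthonormal_on UNIV v" "A *v v i = l i *\<^sub>R v i"
  using assms by (auto simp: eigenframe_def)

text \<open>Orthonormal eigenvectors are found one after the other: the orthogonal complement of those
  already found is again invariant.\<close>

lemma spectral_theorem:
  fixes A :: "real^'n^'n"
  assumes A: "symm A"
  obtains v l where "eigenframe A v l"
proof -
  have "\<exists>(v :: 'n \<Rightarrow> real^'n) l. orthonormal_on F v \<and> (\<forall>i\<in>F. A *v v i = l i *\<^sub>R v i)"
    if "finite F" for F :: "'n set"
    using that
  proof induction
    case empty
    then show ?case by (auto simp: orthonormal_on_def)
  next
    case (insert k F)
    then obtain v l where v: "orthonormal_on F v" "\<forall>i\<in>F. A *v v i = l i *\<^sub>R v i" by blast
    define W where "W = {x. \<forall>i\<in>F. v i \<bullet> x = 0}"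
    have W: "subspace W" by (auto simp: W_def subspace_def inner_add_right)
    have inv: "A *v x \<in> W" if "x \<in> W" for x
      unfolding W_def
    proof (intro CollectI ballI)
      fix i assume i: "i \<in> F"
      have "v i \<bullet> (A *v x) = (l i *\<^sub>R v i) \<bullet> x" using i v(2) by (simp add: symm_inner[OF A])
      then show "v i \<bullet> (A *v x) = 0" using i that by (simp add: W_def)
    qed
    have "F \<noteq> UNIV" using insert by auto
    then obtain x where x: "x \<noteq> 0" "\<And>i. i \<in> F \<Longrightarrow> v i \<bullet> x = 0"
      using orthogonal_to_partial_frame[of F v] by blast
    then have "x \<in> W" by (simp add: W_def)
    with x(1) obtain w c where w: "w \<in> W" "norm w = 1" "A *v w = c *\<^sub>R w"
      using eigenvector_in_invariant_subspace[OF A W inv] by blast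
    have "orthonormal_on (insert k F) (v(k := w))"
      using w insert by (intro orthonormal_on_insert v) (auto simp: W_def)
    moreover have "\<forall>i\<in>insert k F. A *v (v(k := w)) i = (l(k := c)) i *\<^sub>R (v(k := w)) i"
      using v(2) w(3) insert by auto
    ultimately show ?case by blast
  qed
  from this[of UNIV] show thesis using that by (auto simp: eigenframe_def)
qed

definition frame_matrix :: "('n::finite \<Rightarrow> real^'n) \<Rightarrow> real^'n^'n" where
  "frame_matrix v = (\<chi> a i. v i $ a)"

lemma column_frame_matrix [simp]: "column i (frame_matrix v) = v i"
  by (simp add: column_def frame_matrix_def vec_eq_iff)

lemma orthogonal_frame_matrix: "orthonormal_on UNIV v \<Longrightarrow> orthogonal_matrix (frame_matrix v)"
  by (simp add: orthogonal_matrix matrix_mult_transpose_dot_column mat_def orthonormal_on_def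
      vec_eq_iff)

lemma frame_matrix_axis: "frame_matrix v *v axis i 1 = v i"
  by (simp add: matrix_vector_mult_basis)

lemma frame_expansion:
  fixes v :: "'n::finite \<Rightarrow> real^'n"
  assumes "orthonormal_on UNIV v"
  shows "x = (\<Sum>i\<in>UNIV. (v i \<bullet> x) *\<^sub>R v i)"
proof -
  let ?Q = "frame_matrix v"
  have "x = ?Q *v (transpose ?Q *v x)"
    using orthogonal_frame_matrix[OF assms]
    unfolding orthogonal_matrix_def by (metis matrix_vector_mul_assoc matrix_vector_mul_lid)
  also have "\<dots> = (\<Sum>i\<in>UNIV. (transpose ?Q *v x) $ i *s v i)"
    by (subst matrix_mult_sum) (simp del: transpose_matrix_vector)
  also have "\<dots> = (\<Sum>i\<in>UNIV. (v i \<bullet> x) *s v i)"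
    by (intro sum.cong refl, subst matrix_vector_mul_component)
       (simp add: transpose_def frame_matrix_def inner_vec_def)
  finally show ?thesis by (simp add: scalar_mult_eq_scaleR)
qed

text \<open>This reduces identities between functions of one symmetric matrix, such as its inverse or its
  square root, to scalar identities between eigenvalues.\<close>

lemma frame_matrix_eqI:
  fixes A :: "real^'n^'n" and v :: "'n \<Rightarrow> real^'n"
  assumes v: "orthonormal_on UNIV v" and eq: "\<And>i. A *v v i = B *v v i"
  shows "A = B"
proof -
  have "A *v x = B *v x" for x
  proof -
    have "M *v x = (\<Sum>i\<in>UNIV. (v i \<bullet> x) *\<^sub>R (M *v v i))" for M :: "real^'n^'n"
      by (subst frame_expansion[OF v, of x])
         (simp add: linear_sum[OF matrix_vector_mul_linear] matrix_vector_mult_scaleR)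
    then show ?thesis using eq by simp
  qed
  then show ?thesis by (simp add: matrix_eq)
qed

text \<open>The trace is invariant under conjugation with the orthogonal matrix of the frame.\<close>

lemma trace_in_frame:
  fixes A :: "real^'n^'n" and v :: "'n \<Rightarrow> real^'n"
  assumes v: "orthonormal_on UNIV v"
  shows "trace A = (\<Sum>i\<in>UNIV. v i \<bullet> (A *v v i))"
proof -
  let ?Q = "frame_matrix v"
  have "trace A = trace (A ** (?Q ** transpose ?Q))"
    using orthogonal_frame_matrix[OF v] by (simp add: orthogonal_matrix_def)
  also have "\<dots> = trace (transpose ?Q ** (A ** ?Q))"
    by (metis matrix_mul_assoc trace_mul_sym)
  also have "\<dots> = (\<Sum>i\<in>UNIV. v i \<bullet> (A *v v i))"
  proof -
    have "(transpose ?Q ** (A ** ?Q)) $ i $ i = v i \<bullet> (A *v v i)" for i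
    proof -
      have "(transpose ?Q ** (A ** ?Q)) $ i $ i = axis i 1 \<bullet> ((transpose ?Q ** (A ** ?Q)) *v axis i 1)"
        by (simp add: matrix_vector_mult_basis column_def inner_axis' del: transpose_matrix_vector)
      also have "\<dots> = (?Q *v axis i 1) \<bullet> (A *v (?Q *v axis i 1))"
        by (metis dot_lmul_matrix matrix_vector_mul_assoc vector_transpose_matrix)
      finally show ?thesis by (simp add: frame_matrix_axis)
    qed
    then show ?thesis by (simp add: trace_def)
  qed
  finally show ?thesis .
qed

text \<open>This is \<open>\<Sum> c\<^sub>i v\<^sub>i v\<^sub>i\<^sup>T\<close>. It is introduced as the matrix of a linear map because only its action
  on vectors is used.\<close>

definition diag_in_frame :: "('n::finite \<Rightarrow> real^'n) \<Rightarrow> ('n \<Rightarrow> real) \<Rightarrow> real^'n^'n" where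
  "diag_in_frame v c = matrix (\<lambda>x. \<Sum>i\<in>UNIV. (c i * (v i \<bullet> x)) *\<^sub>R v i)"

lemma diag_in_frame_vec:
  "diag_in_frame v c *v x = (\<Sum>i\<in>UNIV. (c i * (v i \<bullet> x)) *\<^sub>R v i)"
proof -
  have "linear (\<lambda>x. \<Sum>i\<in>UNIV. (c i * (v i \<bullet> x)) *\<^sub>R v i)"
    by (rule linearI) (simp_all add: inner_add_right algebra_simps sum.distrib scaleR_sum_right)
  then show ?thesis unfolding diag_in_frame_def
    by (subst matrix_works) (auto simp: linear_matrix_vector_mul_eq)
qed

lemma diag_in_frame_eigen:
  assumes "orthonormal_on UNIV v"
  shows "diag_in_frame v c *v v j = c j *\<^sub>R v j"
proof -
  have "diag_in_frame v c *v v j = (\<Sum>i\<in>UNIV. if i = j then c i *\<^sub>R v i else 0)"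
    unfolding diag_in_frame_vec using assms by (intro sum.cong) (auto simp: orthonormal_on_def)
  then show ?thesis by simp
qed

lemma quad_diag_in_frame: "x \<bullet> (diag_in_frame v c *v x) = (\<Sum>i\<in>UNIV. c i * (v i \<bullet> x)\<^sup>2)"
  unfolding diag_in_frame_vec
  by (simp add: inner_sum_right power2_eq_square inner_commute mult.assoc)

lemma symm_diag_in_frame: "symm (diag_in_frame v c)"
  by (rule symmI) (simp add: diag_in_frame_vec inner_sum_right inner_sum_left inner_commute mult_ac)

lemma psd_diag_in_frame: "(\<And>i. 0 \<le> c i) \<Longrightarrow> psd (diag_in_frame v c)"
  unfolding psd_def by (auto simp: symm_diag_in_frame quad_diag_in_frame intro!: sum_nonneg)

lemma eq_diag_in_frame: "eigenframe A v c \<Longrightarrow> A = diag_in_frame v c"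
  by (metis diag_in_frame_eigen eigenframeD frame_matrix_eqI)

lemma psd_eigenvalue_nonneg:
  assumes "psd A" "A *v v = c *\<^sub>R v" "v \<noteq> 0"
  shows "0 \<le> c"
proof -
  have "0 \<le> c * (v \<bullet> v)" using assms unfolding psd_def by (metis inner_scaleR_right)
  moreover have "0 < v \<bullet> v" using assms(3) by simp
  ultimately show ?thesis by (simp add: zero_le_mult_iff)
qed

lemma orthonormal_nz: "orthonormal_on UNIV v \<Longrightarrow> v i \<noteq> 0"
  by (metis UNIV_I inner_zero_left orthonormal_on_def zero_neq_one)

section \<open>The largest eigenvalue\<close>

lemma eigenvalue_in_frame:
  fixes A :: "real^'n^'n"
  assumes vl: "eigenframe A v l"
    and x: "x \<noteq> 0" "A *v x = k *\<^sub>R x"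
  shows "k \<in> range l"
proof -
  note v = eigenframeD[OF vl]
  have A: "symm A" using eq_diag_in_frame[OF vl] symm_diag_in_frame by metis
  obtain i where i: "v i \<bullet> x \<noteq> 0"
  proof (rule ccontr)
    assume "\<not> thesis"
    then have "v i \<bullet> x = 0" for i using that by blast
    then have "(\<Sum>j\<in>UNIV. (v j \<bullet> x) *\<^sub>R v j) = 0" by simp
    then show False using x(1) unfolding frame_expansion[OF v(1), of x, symmetric] by contradiction
  qed
  have "v i \<bullet> (A *v x) = (A *v v i) \<bullet> x" by (rule symm_inner[OF A])
  then have "k = l i" using i v(2) x(2) by simp
  then show ?thesis by blast
qed

lemma lambda_max_in_frame:
  fixes A :: "real^'n^'n"
  assumes vl: "eigenframe A v l"
  shows "lambda_max A = Max (range l)"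
proof -
  note v = eigenframeD[OF vl]
  have "{k. \<exists>x. x \<noteq> 0 \<and> A *v x = k *\<^sub>R x} = range l"
    using eigenvalue_in_frame[OF vl] v orthonormal_nz[OF v(1)] by fast
  then show ?thesis by (simp add: lambda_max_def)
qed

lemma quad_le_lambda_max:
  fixes A :: "real^'n^'n"
  assumes A: "symm A"
  shows "x \<bullet> (A *v x) \<le> lambda_max A * (x \<bullet> x)"
proof -
  obtain v l where vl: "eigenframe A v l" using spectral_theorem[OF A] .
  note v = eigenframeD[OF vl]
  have "x \<bullet> (A *v x) = (\<Sum>i\<in>UNIV. l i * (v i \<bullet> x)\<^sup>2)"
    unfolding eq_diag_in_frame[OF vl] by (rule quad_diag_in_frame)
  also have "\<dots> \<le> (\<Sum>i\<in>UNIV. lambda_max A * (v i \<bullet> x)\<^sup>2)"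
    by (intro sum_mono mult_right_mono) (auto simp: lambda_max_in_frame[OF vl])
  also have "\<dots> = lambda_max A * (x \<bullet> (\<Sum>i\<in>UNIV. (v i \<bullet> x) *\<^sub>R v i))"
    by (simp add: sum_distrib_left inner_sum_right power2_eq_square inner_commute)
  also have "\<dots> = lambda_max A * (x \<bullet> x)" by (subst frame_expansion[OF v(1), symmetric]) (rule refl)
  finally show ?thesis .
qed

lemma lambda_max_eigenvector:
  fixes A :: "real^'n^'n"
  assumes A: "symm A"
  obtains x where "norm x = 1" "A *v x = lambda_max A *\<^sub>R x"
proof -
  obtain v l where vl: "eigenframe A v l" using spectral_theorem[OF A] .
  note v = eigenframeD[OF vl]
  have "Max (range l) \<in> range l" by (rule Max_in) auto
  then obtain i where "Max (range l) = l i" by (rule rangeE)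
  then have "A *v v i = lambda_max A *\<^sub>R v i" using v(2) by (simp add: lambda_max_in_frame[OF vl])
  moreover have "norm (v i) = 1" using v(1) by (simp add: orthonormal_on_def norm_eq_1)
  ultimately show thesis using that by blast
qed

lemma lambda_max_psd_nonneg:
  assumes "psd A"
  shows "0 \<le> lambda_max A"
proof -
  have "symm A" using assms by (simp add: psd_def)
  then obtain x where x: "norm x = 1" "A *v x = lambda_max A *\<^sub>R x"
    by (rule lambda_max_eigenvector)
  then have "x \<noteq> 0" by auto
  then show ?thesis by (rule psd_eigenvalue_nonneg[OF assms x(2)])
qed

section \<open>Square roots and the polar decomposition\<close>

lemma psd_symm: "psd A \<Longrightarrow> symm A" by (simp add: psd_def)

text \<open>In an eigenframe the quadratic form is a sum of nonnegative terms \<open>l i * (v i \<bullet> x)\<^sup>2\<close>, and each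
  of them vanishes only if the contribution of \<open>v i\<close> to \<open>M *v x\<close> vanishes.\<close>

lemma psd_kernel:
  fixes M :: "real^'n^'n"
  assumes M: "psd M" and x: "x \<bullet> (M *v x) = 0"
  shows "M *v x = 0"
proof -
  obtain v l where vl: "eigenframe M v l" using spectral_theorem[OF psd_symm[OF M]] .
  note v = eigenframeD[OF vl]
  have l: "l i \<ge> 0" for i using psd_eigenvalue_nonneg[OF M v(2) orthonormal_nz[OF v(1)]] .
  have M_eq: "M = diag_in_frame v l" by (rule eq_diag_in_frame[OF vl])
  have "(\<Sum>i\<in>UNIV. l i * (v i \<bullet> x)\<^sup>2) = 0"
    using x unfolding M_eq quad_diag_in_frame .
  then have "\<forall>i\<in>UNIV. l i * (v i \<bullet> x)\<^sup>2 = 0"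
    by (subst (asm) sum_nonneg_eq_0_iff) (auto simp: l)
  then show ?thesis by (auto simp: M_eq diag_in_frame_vec intro!: sum.neutral)
qed

lemma symm_diff: "symm B \<Longrightarrow> symm C \<Longrightarrow> symm (B - C)"
  by (simp add: symm_def transpose_def vec_eq_iff)

text \<open>If \<open>B\<^sup>2 = C\<^sup>2\<close> and \<open>(B - C) x = c x\<close>, then
  \<open>0 = x \<bullet> (B\<^sup>2 - C\<^sup>2) x = c (x \<bullet> B x + x \<bullet> C x)\<close>, so that \<open>c \<noteq> 0\<close> would put \<open>x\<close> in both
  kernels. Hence \<open>B - C\<close> has no eigenvalue other than \<open>0\<close>.\<close>

lemma psd_sqrt_unique:
  fixes B C :: "real^'n^'n"
  assumes B: "psd B" and C: "psd C" and eq: "B ** B = C ** C"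
  shows "B = C"
proof -
  obtain v l where vl: "eigenframe (B - C) v l"
    using spectral_theorem[OF symm_diff[OF psd_symm[OF B] psd_symm[OF C]]] .
  note v = eigenframeD[OF vl]
  have "l i = 0" for i
  proof (rule ccontr)
    let ?x = "v i"
    assume nz: "l i \<noteq> 0"
    have Bx: "B *v ?x = C *v ?x + l i *\<^sub>R ?x"
      using v(2)[of i] by (simp add: matrix_vector_mult_diff_rdistrib algebra_simps)
    have "(B *v ?x) \<bullet> (B *v ?x) = (C *v ?x) \<bullet> (C *v ?x)"
      using symm_inner[OF psd_symm[OF B], of ?x "B *v ?x"] symm_inner[OF psd_symm[OF C], of ?x "C *v ?x"]
      by (simp add: matrix_vector_mul_assoc eq)
    then have "l i * (?x \<bullet> (C *v ?x) + ?x \<bullet> (C *v ?x + l i *\<^sub>R ?x)) = 0"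
      unfolding Bx by (simp add: inner_add_left inner_add_right inner_commute algebra_simps)
    then have "?x \<bullet> (C *v ?x) + ?x \<bullet> (B *v ?x) = 0" using nz by (simp add: Bx)
    moreover have "0 \<le> ?x \<bullet> (B *v ?x)" "0 \<le> ?x \<bullet> (C *v ?x)" using B C by (auto simp: psd_def)
    ultimately have "?x \<bullet> (B *v ?x) = 0" "?x \<bullet> (C *v ?x) = 0" by linarith+
    then have "B *v ?x = 0" "C *v ?x = 0" using psd_kernel B C by blast+
    then show False using nz Bx orthonormal_nz[OF v(1), of i] by simp
  qed
  then have "B - C = 0" using v by (intro frame_matrix_eqI[OF v(1)]) simp
  then show ?thesis by simp
qed

lemma psd_sqrt:
  fixes A :: "real^'n^'n"
  assumes A: "psd A"
  shows "psd (psd_sqrt A)" "psd_sqrt A ** psd_sqrt A = A"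
proof -
  obtain v l where vl: "eigenframe A v l" using spectral_theorem[OF psd_symm[OF A]] .
  note v = eigenframeD[OF vl]
  have l: "l i \<ge> 0" for i using psd_eigenvalue_nonneg[OF A v(2) orthonormal_nz[OF v(1)]] .
  define B where "B = diag_in_frame v (\<lambda>i. sqrt (l i))"
  have B: "psd B" unfolding B_def by (rule psd_diag_in_frame) (simp add: l)
  have BB: "B ** B = A"
    by (rule frame_matrix_eqI[OF v(1)])
       (simp add: v(2) B_def diag_in_frame_eigen[OF v(1)] matrix_vector_mult_scaleR l
         flip: matrix_vector_mul_assoc)
  have "psd (psd_sqrt A) \<and> psd_sqrt A ** psd_sqrt A = A"
    unfolding psd_sqrt_def by (rule theI[of _ B]) (use B BB psd_sqrt_unique in auto)
  then show "psd (psd_sqrt A)" "psd_sqrt A ** psd_sqrt A = A" by auto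
qed

lemma psd_sqrt_eqI: "psd B \<Longrightarrow> B ** B = A \<Longrightarrow> psd_sqrt A = B"
  unfolding psd_sqrt_def by (rule the_equality) (auto intro: psd_sqrt_unique)

lemma psd_gram: "psd (X ** transpose X)"
proof -
  have "x \<bullet> ((X ** transpose X) *v x) = (transpose X *v x) \<bullet> (transpose X *v x)" for x
    by (metis dot_lmul_matrix matrix_vector_mul_assoc transpose_matrix_vector)
  then show ?thesis by (simp add: psd_def symm_def matrix_transpose_mul)
qed

lemma psd_gram': "psd (transpose X ** X)"
  using psd_gram[of "transpose X"] by simp

text \<open>On the eigenvectors \<open>v i\<close> of \<open>R = psd_sqrt (transpose P ** P)\<close> with eigenvalue \<open>r i \<noteq> 0\<close> the
  vectors \<open>P *v v i / r i\<close> are orthonormal. They are completed to a frame \<open>u\<close>, and \<open>U\<close> sends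
  \<open>v i\<close> to \<open>u i\<close>. The choice on the kernel of \<open>R\<close> is free, since \<open>P\<close> vanishes there too.\<close>

lemma polar_decomposition:
  fixes P :: "real^'n^'n"
  obtains U where "orthogonal_matrix U" "P = U ** psd_sqrt (transpose P ** P)"
proof -
  let ?R = "psd_sqrt (transpose P ** P)"
  have R: "psd ?R" "?R ** ?R = transpose P ** P" using psd_sqrt[OF psd_gram'] by auto
  obtain v r where vl: "eigenframe ?R v r" using spectral_theorem[OF psd_symm[OF R(1)]] .
  note v = eigenframeD[OF vl]
  have gram: "(P *v v i) \<bullet> (P *v v j) = (if i = j then (r i)\<^sup>2 else 0)" for i j
  proof -
    have "(P *v v i) \<bullet> (P *v v j) = v i \<bullet> ((transpose P ** P) *v v j)"
      by (metis dot_lmul_matrix matrix_vector_mul_assoc vector_transpose_matrix)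
    also have "\<dots> = v i \<bullet> (?R *v (?R *v v j))" by (metis R(2) matrix_vector_mul_assoc)
    also have "\<dots> = r j * r j * (v i \<bullet> v j)" by (simp add: v(2) matrix_vector_mult_scaleR)
    finally show ?thesis using v(1) by (auto simp: orthonormal_on_def power2_eq_square)
  qed
  define I where "I = {i. r i \<noteq> 0}"
  have "orthonormal_on I (\<lambda>i. (P *v v i) /\<^sub>R r i)"
    by (auto simp: orthonormal_on_def gram I_def power2_eq_square field_simps)
  then obtain u where u: "orthonormal_on UNIV u" "\<And>i. i \<in> I \<Longrightarrow> u i = (P *v v i) /\<^sub>R r i"
    using orthonormal_extend by blast
  define U where "U = frame_matrix u ** transpose (frame_matrix v)"
  have "orthogonal_matrix U" unfolding U_def
    by (intro orthogonal_matrix_mul) (simp_all add: orthogonal_frame_matrix u v)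
  moreover have Uv: "U *v v i = u i" for i
  proof -
    have "transpose (frame_matrix v) *v (frame_matrix v *v axis i 1) = axis i 1"
      using orthogonal_frame_matrix[OF v(1)] unfolding orthogonal_matrix_def
      by (metis matrix_vector_mul_assoc matrix_vector_mul_lid)
    then show ?thesis
      unfolding U_def by (metis frame_matrix_axis matrix_vector_mul_assoc)
  qed
  moreover have "P = U ** ?R"
  proof (rule frame_matrix_eqI[OF v(1)])
    fix i
    have "(U ** ?R) *v v i = r i *\<^sub>R u i"
      by (simp add: v(2) matrix_vector_mult_scaleR Uv flip: matrix_vector_mul_assoc)
    also have "\<dots> = P *v v i"
    proof (cases "i \<in> I")
      case True
      then show ?thesis by (simp add: u(2) I_def)
    next
      case False
      then show ?thesis using gram[of i i] by (simp add: I_def)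
    qed
    finally show "P *v v i = (U ** ?R) *v v i" by simp
  qed
  ultimately show thesis using that by blast
qed

section \<open>The trace inner product\<close>

lemma matrix_sub_rdistrib: "(A - B) ** C = A ** C - B ** (C :: real^'n^'n)"
  by (simp add: matrix_eq matrix_vector_mult_diff_rdistrib flip: matrix_vector_mul_assoc)

lemma matrix_sub_ldistrib: "A ** (B - C) = A ** B - A ** (C :: real^'n^'n)"
  by (simp add: matrix_eq matrix_vector_mult_diff_rdistrib matrix_vector_mult_diff_distrib
      flip: matrix_vector_mul_assoc)

lemma matrix_add_rdistrib: "(A + B) ** C = A ** C + B ** (C :: real^'n^'n)"
  by (simp add: matrix_eq matrix_vector_mult_add_rdistrib flip: matrix_vector_mul_assoc)

lemma transpose_minus: "transpose (A - B) = transpose A - transpose (B :: real^'n^'n)"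
  by (simp add: transpose_def vec_eq_iff)

lemma inner_eq_trace: "A \<bullet> (B :: real^'n^'n) = trace (transpose A ** B)"
  using frob_inner_eq_inner[of A B] by (simp add: frob_inner_def)

lemma inner_mult_left:
  fixes A B C :: "real^'n^'n"
  shows "(A ** B) \<bullet> C = B \<bullet> (transpose A ** C)"
  by (simp add: inner_eq_trace matrix_transpose_mul matrix_mul_assoc)

lemma inner_mult_right:
  fixes A B C :: "real^'n^'n"
  shows "(A ** B) \<bullet> C = A \<bullet> (C ** transpose B)"
proof -
  have "(A ** B) \<bullet> C = trace (transpose B ** (transpose A ** C))"
    by (simp add: inner_eq_trace matrix_transpose_mul matrix_mul_assoc)
  also have "\<dots> = trace ((transpose A ** C) ** transpose B)" by (rule trace_mul_sym)
  finally show ?thesis by (simp add: inner_eq_trace matrix_mul_assoc)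
qed

lemma inner_symm_mult: "symm A \<Longrightarrow> (A ** B) \<bullet> C = B \<bullet> (A ** (C :: real^'n^'n))"
  by (simp add: inner_mult_left symm_def)

lemma inner_transpose: "transpose A \<bullet> transpose B = A \<bullet> (B :: real^'n^'n)"
  by (simp add: inner_eq_trace) (metis matrix_transpose_mul trace_mul_sym transpose_transpose inner_commute inner_eq_trace)

lemma norm_transpose: "norm (transpose A) = norm (A :: real^'n^'n)"
  by (simp add: norm_eq_sqrt_inner inner_transpose)

lemma trace_gram: "trace (X ** transpose X) = X \<bullet> (X :: real^'n^'n)"
  by (simp add: inner_eq_trace) (rule trace_mul_sym)

lemma norm_orthogonal_mult:
  "orthogonal_matrix U \<Longrightarrow> norm (U ** A) = norm (A :: real^'n^'n)"
  by (simp add: norm_eq_sqrt_inner inner_mult_left matrix_mul_assoc orthogonal_matrix)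

lemma inner_in_frame:
  fixes B T :: "real^'n^'n"
  assumes vl: "eigenframe B v b"
  shows "B \<bullet> T = (\<Sum>i\<in>UNIV. b i * (v i \<bullet> (T *v v i)))"
proof -
  note v = eigenframeD[OF vl]
  have "B \<bullet> T = trace (transpose T ** B)" by (simp add: inner_commute flip: inner_eq_trace)
  also have "\<dots> = (\<Sum>i\<in>UNIV. v i \<bullet> ((transpose T ** B) *v v i))" by (rule trace_in_frame[OF v(1)])
  also have "\<dots> = (\<Sum>i\<in>UNIV. b i * (v i \<bullet> (T *v v i)))"
  proof (rule sum.cong[OF refl])
    fix i
    have "v i \<bullet> ((transpose T ** B) *v v i) = v i \<bullet> (transpose T *v (B *v v i))"
      by (simp only: matrix_vector_mul_assoc)
    also have "\<dots> = (T *v v i) \<bullet> (b i *\<^sub>R v i)"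
      by (metis dot_lmul_matrix v(2) vector_transpose_matrix)
    finally show "v i \<bullet> ((transpose T ** B) *v v i) = b i * (v i \<bullet> (T *v v i))"
      by (simp add: inner_commute)
  qed
  finally show ?thesis .
qed

text \<open>The inner product of matrices is the sum of the inner products of their columns, so the
  bound on the quadratic form is applied column by column.\<close>

lemma inner_mult_ge:
  fixes A Z :: "real^'n^'n"
  assumes "\<And>x. c * (x \<bullet> x) \<le> x \<bullet> (A *v x)"
  shows "c * (Z \<bullet> Z) \<le> Z \<bullet> (A ** Z)"
proof -
  have cols: "Z \<bullet> W = (\<Sum>j\<in>UNIV. column j Z \<bullet> column j W)" for W :: "real^'n^'n"
    by (subst inner_transpose[symmetric]) (simp add: inner_vec_def transpose_def column_def)
  have col: "column j (A ** Z) = A *v column j Z" for j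
    by (simp add: column_def matrix_matrix_mult_def matrix_vector_mult_def)
  show ?thesis unfolding cols col sum_distrib_left by (intro sum_mono assms)
qed

text \<open>For nonnegative eigenvalues, \<open>\<Sum> p\<^sub>i\<^sup>2 \<le> (\<Sum> p\<^sub>i)\<^sup>2\<close>.\<close>

lemma norm_psd_le_trace:
  fixes P :: "real^'n^'n"
  assumes P: "psd P"
  shows "norm P \<le> trace P"
proof -
  obtain v p where vl: "eigenframe P v p" using spectral_theorem[OF psd_symm[OF P]] .
  note v = eigenframeD[OF vl]
  have p: "p i \<ge> 0" for i using psd_eigenvalue_nonneg[OF P v(2) orthonormal_nz[OF v(1)]] .
  have quad: "v i \<bullet> (P *v v i) = p i" for i
    using v(1) by (simp add: v(2) orthonormal_on_def)
  have tr: "trace P = (\<Sum>i\<in>UNIV. p i)" by (simp add: trace_in_frame[OF v(1)] quad)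
  have "(norm P)\<^sup>2 = (\<Sum>i\<in>UNIV. p i * p i)"
    by (simp add: power2_norm_eq_inner inner_in_frame[OF vl] quad)
  also have "\<dots> \<le> (\<Sum>i\<in>UNIV. p i * trace P)"
    unfolding tr by (intro sum_mono mult_left_mono p member_le_sum) (auto simp: p)
  also have "\<dots> = (trace P)\<^sup>2" by (simp add: tr power2_eq_square flip: sum_distrib_right)
  finally show ?thesis by (rule power2_le_imp_le) (simp add: tr p sum_nonneg)
qed

section \<open>The Gelbrich distance as a distance between square roots\<close>

lemma psd_sqrt_mult_transpose: "psd T \<Longrightarrow> psd_sqrt T ** transpose (psd_sqrt T) = T"
  using psd_sqrt[of T] by (simp add: psd_def symm_def)

lemma transpose_psd_sqrt: "psd T \<Longrightarrow> transpose (psd_sqrt T) = psd_sqrt T"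
  using psd_sqrt[of T] by (simp add: psd_def symm_def)

text \<open>The distance of \<open>X\<close> from \<open>psd_sqrt T\<close>, up to a correction that measures how far the coupling
  \<open>X \<bullet> psd_sqrt T\<close> is from its optimal value.\<close>

lemma gelbrich_eq:
  fixes X T :: "real^'n^'n"
  assumes T: "psd T"
  shows "gelbrich (X ** transpose X) T =
    sqrt ((norm (X - psd_sqrt T))\<^sup>2 + 2 * (X \<bullet> psd_sqrt T
      - trace (psd_sqrt (psd_sqrt T ** (X ** transpose X) ** psd_sqrt T))))"
proof -
  let ?Y = "psd_sqrt T"
  let ?R = "psd_sqrt (?Y ** (X ** transpose X) ** ?Y)"
  have "trace T = ?Y \<bullet> ?Y"
    using trace_gram[of ?Y] by (simp add: psd_sqrt_mult_transpose[OF T])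
  moreover have "trace (2 *\<^sub>R ?R) = 2 * trace ?R" by (simp add: trace_def sum_distrib_left)
  ultimately have "trace (X ** transpose X + T - 2 *\<^sub>R ?R) = X \<bullet> X + ?Y \<bullet> ?Y - 2 * trace ?R"
    by (simp add: trace_add trace_sub trace_gram)
  also have "\<dots> = (norm (X - ?Y))\<^sup>2 + 2 * (X \<bullet> ?Y - trace ?R)"
    by (simp add: power2_norm_eq_inner inner_diff_left inner_diff_right inner_commute)
  finally show ?thesis by (simp add: gelbrich_def)
qed

text \<open>Writing \<open>R = C ** C\<close> turns both sides into inner products of matrices of norm \<open>norm C\<close>, and
  the claim is the Cauchy-Schwarz inequality.\<close>

lemma trace_orthogonal_mult_le:
  fixes R :: "real^'n^'n"
  assumes U: "orthogonal_matrix U" and R: "psd R"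
  shows "trace (U ** R) \<le> trace R"
proof -
  define C where "C = psd_sqrt R"
  have C: "C ** C = R" "transpose C = C"
    using psd_sqrt(2)[OF R] transpose_psd_sqrt[OF R] by (auto simp: C_def)
  have "trace (U ** R) = transpose (U ** C) \<bullet> C"
    by (simp add: inner_eq_trace matrix_mul_assoc flip: C(1))
  also have "\<dots> \<le> norm (transpose (U ** C)) * norm C" by (rule norm_cauchy_schwarz)
  also have "\<dots> = C \<bullet> C"
    by (simp add: norm_transpose norm_orthogonal_mult[OF U] flip: power2_eq_square power2_norm_eq_inner)
  also have "\<dots> = trace R" by (simp add: inner_eq_trace C)
  finally show ?thesis .
qed

text \<open>The correction term in \<open>gelbrich_eq\<close> is never positive: \<open>X \<bullet> psd_sqrt T\<close> is the trace of
  \<open>P = transpose X ** psd_sqrt T\<close>, and by polar decomposition it is at most the trace of the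
  positive semidefinite factor of \<open>P\<close>.\<close>

lemma gelbrich_gram_le:
  fixes X T :: "real^'n^'n"
  assumes T: "psd T"
  shows "gelbrich (X ** transpose X) T \<le> norm (X - psd_sqrt T)"
proof -
  let ?Y = "psd_sqrt T"
  let ?P = "transpose X ** ?Y"
  obtain U where U: "orthogonal_matrix U" "?P = U ** psd_sqrt (transpose ?P ** ?P)"
    using polar_decomposition[of ?P] .
  have PP: "transpose ?P ** ?P = ?Y ** (X ** transpose X) ** ?Y"
    by (simp add: matrix_transpose_mul transpose_psd_sqrt[OF T] matrix_mul_assoc)
  have "X \<bullet> ?Y = trace (U ** psd_sqrt (transpose ?P ** ?P))" using U(2) by (simp add: inner_eq_trace)
  also have "\<dots> \<le> trace (psd_sqrt (transpose ?P ** ?P))"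
    by (intro trace_orthogonal_mult_le U psd_sqrt psd_gram')
  finally have "X \<bullet> ?Y \<le> trace (psd_sqrt (?Y ** (X ** transpose X) ** ?Y))" by (simp add: PP)
  then show ?thesis
    unfolding gelbrich_eq[OF T] by (intro real_le_lsqrt) auto
qed

text \<open>Among the square roots \<open>psd_sqrt S ** U\<close> of \<open>S\<close> with \<open>U\<close> orthogonal, the polar factor \<open>U\<close> of
  \<open>psd_sqrt S ** psd_sqrt T\<close> makes the correction term zero.\<close>

lemma gelbrich_attained:
  fixes S T :: "real^'n^'n"
  assumes S: "psd S" and T: "psd T"
  obtains X where "X ** transpose X = S" "gelbrich S T = norm (X - psd_sqrt T)"
proof -
  let ?Y = "psd_sqrt T" and ?Z = "psd_sqrt S"
  let ?P = "?Z ** ?Y"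
  let ?R = "psd_sqrt (transpose ?P ** ?P)"
  obtain U where U: "orthogonal_matrix U" "?P = U ** ?R"
    using polar_decomposition[of ?P] .
  have UU: "U ** transpose U = mat 1" "transpose U ** U = mat 1"
    using U(1) by (auto simp: orthogonal_matrix_def)
  define X where "X = ?Z ** U"
  have "X ** transpose X = ?Z ** (U ** transpose U) ** transpose ?Z"
    by (simp add: X_def matrix_transpose_mul matrix_mul_assoc)
  then have XX: "X ** transpose X = S" by (simp add: UU psd_sqrt_mult_transpose[OF S])
  have PP: "transpose ?P ** ?P = ?Y ** S ** ?Y"
  proof -
    have "transpose ?P ** ?P = ?Y ** (?Z ** ?Z) ** ?Y"
      by (simp add: matrix_transpose_mul transpose_psd_sqrt S T matrix_mul_assoc)
    then show ?thesis by (simp add: psd_sqrt(2)[OF S])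
  qed
  have "X \<bullet> ?Y = trace (transpose U ** ?P)"
    by (simp add: inner_eq_trace X_def matrix_transpose_mul transpose_psd_sqrt[OF S] matrix_mul_assoc)
  also have "\<dots> = trace ((transpose U ** U) ** ?R)" using U(2) by (metis matrix_mul_assoc)
  also have "\<dots> = trace (psd_sqrt (?Y ** S ** ?Y))" by (simp add: UU PP)
  finally have "gelbrich S T = norm (X - ?Y)" using gelbrich_eq[OF T, of X] by (simp add: XX)
  with XX show thesis by (rule that)
qed

text \<open>A positive semidefinite \<open>A\<close> is an optimal transport map from \<open>T\<close> to \<open>A ** T ** A\<close>: the
  matrix root in the definition of the distance is explicitly \<open>Y ** A ** Y\<close> with
  \<open>Y = psd_sqrt T\<close>, and its trace is the coupling of \<open>A ** Y\<close> with \<open>Y\<close>.\<close>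

lemma gelbrich_transport:
  fixes A T :: "real^'n^'n"
  assumes A: "psd A" and T: "psd T"
  shows "gelbrich (A ** T ** A) T = norm (A ** psd_sqrt T - psd_sqrt T)"
proof -
  let ?Y = "psd_sqrt T" and ?X = "A ** psd_sqrt T" and ?R = "psd_sqrt T ** A ** psd_sqrt T"
  have At: "transpose A = A" using A by (simp add: psd_def symm_def)
  have XX: "?X ** transpose ?X = A ** T ** A"
  proof -
    have "?X ** transpose ?X = A ** (?Y ** ?Y) ** A"
      by (simp add: matrix_transpose_mul transpose_psd_sqrt[OF T] At matrix_mul_assoc)
    then show ?thesis by (simp add: psd_sqrt(2)[OF T])
  qed
  have "psd ?R"
  proof -
    have "?R = ?Y ** (psd_sqrt A ** psd_sqrt A) ** ?Y" by (simp add: psd_sqrt(2)[OF A])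
    also have "\<dots> = (?Y ** psd_sqrt A) ** transpose (?Y ** psd_sqrt A)"
      by (simp add: matrix_transpose_mul transpose_psd_sqrt A T matrix_mul_assoc)
    finally show ?thesis using psd_gram by metis
  qed
  moreover have "?R ** ?R = ?Y ** (A ** T ** A) ** ?Y"
  proof -
    have "?R ** ?R = ?Y ** (A ** (?Y ** ?Y) ** A) ** ?Y" by (simp add: matrix_mul_assoc)
    then show ?thesis by (simp add: psd_sqrt(2)[OF T])
  qed
  ultimately have R: "psd_sqrt (?Y ** (A ** T ** A) ** ?Y) = ?R" by (rule psd_sqrt_eqI)
  have "?X \<bullet> ?Y = trace ?R"
    by (simp add: inner_eq_trace matrix_transpose_mul transpose_psd_sqrt[OF T] At)
  then show ?thesis using gelbrich_eq[OF T, of ?X] unfolding XX R by simp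
qed

lemma gelbrich_ball_eq:
  fixes T :: "real^'n^'n"
  assumes T: "psd T"
  shows "gelbrich_ball T \<epsilon> = (\<lambda>X. X ** transpose X) ` cball (psd_sqrt T) \<epsilon>"
proof (intro set_eqI iffI)
  fix S assume "S \<in> gelbrich_ball T \<epsilon>"
  then have S: "psd S" "gelbrich S T \<le> \<epsilon>" by (auto simp: gelbrich_ball_def)
  obtain X where "X ** transpose X = S" "gelbrich S T = norm (X - psd_sqrt T)"
    using gelbrich_attained[OF S(1) T] .
  then show "S \<in> (\<lambda>X. X ** transpose X) ` cball (psd_sqrt T) \<epsilon>"
    using S(2) by (auto simp: dist_norm norm_minus_commute intro!: image_eqI[of _ _ X])
next
  fix S assume "S \<in> (\<lambda>X. X ** transpose X) ` cball (psd_sqrt T) \<epsilon>"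
  then obtain X where X: "S = X ** transpose X" "norm (X - psd_sqrt T) \<le> \<epsilon>"
    by (auto simp: dist_norm norm_minus_commute)
  then show "S \<in> gelbrich_ball T \<epsilon>"
    using gelbrich_gram_le[OF T, of X] psd_gram[of X] by (auto simp: gelbrich_ball_def)
qed

lemma continuous_gram: "continuous_on A (\<lambda>X :: real^'n^'n. X ** transpose X)"
  unfolding matrix_matrix_mult_def transpose_def by (intro continuous_intros)

lemma compact_gelbrich_ball: "psd T \<Longrightarrow> compact (gelbrich_ball T \<epsilon>)"
  unfolding gelbrich_ball_eq by (intro compact_continuous_image continuous_gram compact_cball)

lemma center_in_gelbrich_ball: "psd T \<Longrightarrow> 0 \<le> \<epsilon> \<Longrightarrow> T \<in> gelbrich_ball T \<epsilon>"
  unfolding gelbrich_ball_eq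
  by (rule image_eqI[of _ _ "psd_sqrt T"]) (auto simp: psd_sqrt_mult_transpose)

text \<open>With \<open>X = Y + E\<close> one has \<open>S = T + Y E\<^sup>T + E Y + E E\<^sup>T\<close>. The mixed terms are bounded with
  \<open>Y ** Y = T\<close> and \<open>x \<bullet> (T *v x) \<le> lambda_max T * (x \<bullet> x)\<close>, which is sharper than
  submultiplicativity of the Frobenius norm.\<close>

lemma norm_gelbrich_ball_le:
  fixes T :: "real^'n^'n"
  assumes T: "psd T" and S: "S \<in> gelbrich_ball T \<epsilon>"
  shows "norm S \<le> (2 * sqrt (lambda_max T) + \<epsilon>) * \<epsilon> + norm T"
proof -
  let ?Y = "psd_sqrt T"
  obtain X where X: "S = X ** transpose X" "norm (X - ?Y) \<le> \<epsilon>"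
    using S unfolding gelbrich_ball_eq[OF T] by (auto simp: dist_norm norm_minus_commute)
  define E where "E = X - ?Y"
  have E: "norm E \<le> \<epsilon>" using X by (simp add: E_def)
  have \<epsilon>: "0 \<le> \<epsilon>" using E norm_ge_zero[of E] by linarith
  have Yt: "transpose ?Y = ?Y" by (rule transpose_psd_sqrt[OF T])
  have YE: "norm (?Y ** transpose E) \<le> sqrt (lambda_max T) * norm E"
  proof -
    let ?Z = "transpose E"
    have "(- lambda_max T) * (?Z \<bullet> ?Z) \<le> ?Z \<bullet> (- T ** ?Z)"
      by (rule inner_mult_ge)
         (use quad_le_lambda_max[OF psd_symm[OF T]] in \<open>simp add: matrix_vector_mult_diff_rdistrib[of 0, simplified]\<close>)
    moreover have "- T ** ?Z = - (T ** ?Z)" using matrix_sub_rdistrib[of 0 T ?Z] by simp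
    moreover have "(?Y ** ?Z) \<bullet> (?Y ** ?Z) = ?Z \<bullet> (T ** ?Z)"
      by (simp add: inner_mult_left Yt matrix_mul_assoc psd_sqrt(2)[OF T])
    ultimately have "(norm (?Y ** ?Z))\<^sup>2 \<le> lambda_max T * (norm E)\<^sup>2"
      by (simp add: power2_norm_eq_inner inner_transpose)
    also have "\<dots> = (sqrt (lambda_max T) * norm E)\<^sup>2"
      using lambda_max_psd_nonneg[OF T] by (simp add: power_mult_distrib)
    finally show ?thesis
      by (rule power2_le_imp_le) (simp add: lambda_max_psd_nonneg[OF T])
  qed
  have EY: "norm (E ** ?Y) = norm (?Y ** transpose E)"
    using norm_transpose[of "E ** ?Y"] by (simp add: matrix_transpose_mul Yt)
  have EE: "norm (E ** transpose E) \<le> norm E * norm E"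
  proof -
    have "norm (E ** transpose E) \<le> trace (E ** transpose E)" by (rule norm_psd_le_trace[OF psd_gram])
    then show ?thesis by (simp add: trace_gram flip: power2_eq_square power2_norm_eq_inner)
  qed
  have "S = T + ?Y ** transpose E + E ** ?Y + E ** transpose E"
  proof -
    have "transpose X = ?Y + transpose E" by (simp add: E_def transpose_minus Yt)
    moreover have "X = ?Y + E" by (simp add: E_def)
    ultimately have "S = (?Y + E) ** (?Y + transpose E)" using X(1) by simp
    then show ?thesis
      by (simp add: matrix_add_ldistrib matrix_add_rdistrib psd_sqrt(2)[OF T] add_ac)
  qed
  then have "norm S \<le> norm T + norm (?Y ** transpose E) + norm (E ** ?Y) + norm (E ** transpose E)"
    by (metis (no_types, lifting) add_mono norm_triangle_le norm_triangle_ineq order_refl)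
  also have "\<dots> \<le> norm T + 2 * (sqrt (lambda_max T) * norm E) + norm E * norm E"
    using YE EY EE by linarith
  also have "\<dots> \<le> norm T + 2 * (sqrt (lambda_max T) * \<epsilon>) + \<epsilon> * \<epsilon>"
    using E \<epsilon> lambda_max_psd_nonneg[OF T] by (intro add_mono mult_left_mono mult_mono) auto
  finally show ?thesis by (simp add: algebra_simps)
qed

section \<open>The resolvent of the cost matrix\<close>

lemma matrix_inv_eqI:
  fixes A B :: "real^'n^'n"
  assumes "A ** B = mat 1" "B ** A = mat 1"
  shows "matrix_inv A = B"
proof -
  have "A ** matrix_inv A = mat 1 \<and> matrix_inv A ** A = mat 1"
    unfolding matrix_inv_def by (rule someI[of _ B]) (use assms in simp)
  then show ?thesis by (metis assms(2) matrix_mul_assoc matrix_mul_lid matrix_mul_rid)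
qed

lemma lambda_max_uminus_in_frame:
  assumes vl: "eigenframe \<Lambda> v l"
  shows "- l i \<le> lambda_max (- \<Lambda>)"
proof -
  have "(- \<Lambda>) *v x = - (\<Lambda> *v x)" for x
    using matrix_vector_mult_diff_rdistrib[of 0 \<Lambda> x] by simp
  then have "eigenframe (- \<Lambda>) v (\<lambda>i. - l i)"
    using eigenframeD[OF vl] by (simp add: eigenframe_def)
  then show ?thesis by (simp add: lambda_max_in_frame)
qed

lemma shift_pos: "eigenframe \<Lambda> v l \<Longrightarrow> lambda_max (- \<Lambda>) < \<gamma> \<Longrightarrow> 0 < \<gamma> + l i"
  using lambda_max_uminus_in_frame[of \<Lambda> v l i] by simp

lemma eigenframe_shift:
  "eigenframe \<Lambda> v l \<Longrightarrow> eigenframe (\<gamma> *\<^sub>R mat 1 + \<Lambda>) v (\<lambda>i. \<gamma> + l i)"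
  by (simp add: eigenframe_def matrix_vector_mult_add_rdistrib algebra_simps
      flip: scaleR_matrix_vector_assoc)

lemma
  fixes \<Lambda> :: "real^'n^'n"
  assumes vl: "eigenframe \<Lambda> v l" and \<gamma>: "lambda_max (- \<Lambda>) < \<gamma>"
  defines "M \<equiv> \<gamma> *\<^sub>R mat 1 + \<Lambda>"
  shows resolvent: "M ** matrix_inv M = mat 1"
    and eigenframe_resolvent: "eigenframe (matrix_inv M) v (\<lambda>i. 1 / (\<gamma> + l i))"
proof -
  note v = eigenframeD[OF vl]
  note Mv = eigenframeD(2)[OF eigenframe_shift[OF vl, of \<gamma>], folded M_def]
  have nz: "\<gamma> + l i \<noteq> 0" for i using shift_pos[OF vl \<gamma>, of i] by simp
  define N where "N = diag_in_frame v (\<lambda>i. 1 / (\<gamma> + l i))"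
  have N: "N *v v i = (1 / (\<gamma> + l i)) *\<^sub>R v i" for i
    unfolding N_def by (rule diag_in_frame_eigen[OF v(1)])
  have MN: "M ** N = mat 1" and NM: "N ** M = mat 1"
    using nz by (auto intro!: frame_matrix_eqI[OF v(1)]
        simp: N Mv matrix_vector_mult_scaleR simp flip: matrix_vector_mul_assoc)
  have "matrix_inv M = N" by (rule matrix_inv_eqI[OF MN NM])
  then show "M ** matrix_inv M = mat 1" "eigenframe (matrix_inv M) v (\<lambda>i. 1 / (\<gamma> + l i))"
    using MN N v(1) by (auto simp: eigenframe_def)
qed

text \<open>The optimal transport map \<open>\<gamma> (\<gamma> I + \<Lambda>)\<^sup>-\<^sup>1\<close> from \<open>T\<close> to \<open>Sigma_star T \<Lambda> \<gamma>\<close>.\<close>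

definition transport :: "real^'n^'n \<Rightarrow> real \<Rightarrow> real^'n^'n" where
  "transport \<Lambda> \<gamma> = \<gamma> *\<^sub>R matrix_inv (\<gamma> *\<^sub>R mat 1 + \<Lambda>)"

lemma Sigma_star_transport: "Sigma_star T \<Lambda> \<gamma> = transport \<Lambda> \<gamma> ** T ** transport \<Lambda> \<gamma>"
  by (simp add: Sigma_star_def transport_def power2_eq_square matrix_scalar_ac
      flip: scalar_matrix_assoc)

lemma eigenframe_transport:
  assumes vl: "eigenframe \<Lambda> v l" and \<gamma>: "lambda_max (- \<Lambda>) < \<gamma>"
  shows "eigenframe (transport \<Lambda> \<gamma>) v (\<lambda>i. \<gamma> / (\<gamma> + l i))"
  using eigenframe_resolvent[OF assms]
  by (simp add: eigenframe_def transport_def flip: scaleR_matrix_vector_assoc)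

lemma psd_transport:
  assumes vl: "eigenframe \<Lambda> v l" and \<gamma>: "lambda_max (- \<Lambda>) < \<gamma>" "0 \<le> \<gamma>"
  shows "psd (transport \<Lambda> \<gamma>)"
  unfolding eq_diag_in_frame[OF eigenframe_transport[OF vl \<gamma>(1)]]
  using shift_pos[OF vl \<gamma>(1)] \<gamma>(2) by (intro psd_diag_in_frame) (simp add: less_imp_le)

lemma eigenframe_id_minus_transport:
  assumes vl: "eigenframe \<Lambda> v l" and \<gamma>: "lambda_max (- \<Lambda>) < \<gamma>"
  shows "eigenframe (mat 1 - transport \<Lambda> \<gamma>) v (\<lambda>i. l i / (\<gamma> + l i))"
proof -
  have "v i - (\<gamma> / (\<gamma> + l i)) *\<^sub>R v i = (l i / (\<gamma> + l i)) *\<^sub>R v i" for i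
  proof -
    have "l i / (\<gamma> + l i) = 1 - \<gamma> / (\<gamma> + l i)"
      using shift_pos[OF assms, of i] by (simp add: field_simps)
    then show ?thesis by (simp add: scaleR_diff_left)
  qed
  then show ?thesis using eigenframeD[OF eigenframe_transport[OF assms]]
    by (simp add: eigenframe_def matrix_vector_mult_diff_rdistrib)
qed

text \<open>The coefficients \<open>v i \<bullet> (T *v v i)\<close> are nonnegative, so concavity and monotonicity in \<open>\<gamma>\<close> can be
  read off term by term here and in \<open>gelbrich_Sigma_star_in_frame\<close>.\<close>

lemma objective_in_frame:
  fixes T :: "real^'n^'n"
  assumes vl: "eigenframe \<Lambda> v l" and \<gamma>: "lambda_max (- \<Lambda>) < \<gamma>"
  shows "gamma_objective T \<epsilon> \<Lambda> \<gamma> =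
    (\<Sum>i\<in>UNIV. \<gamma> * l i / (\<gamma> + l i) * (v i \<bullet> (T *v v i))) - \<gamma> * \<epsilon>\<^sup>2"
  using inner_in_frame[OF eigenframe_id_minus_transport[OF assms], of T]
  by (simp add: gamma_objective_def frob_inner_eq_inner right_diff_distrib sum_distrib_left mult.assoc
      flip: transport_def)

lemma gelbrich_Sigma_star:
  fixes T :: "real^'n^'n"
  assumes vl: "eigenframe \<Lambda> v l" and \<gamma>: "lambda_max (- \<Lambda>) < \<gamma>" "0 \<le> \<gamma>" and T: "psd T"
  shows "gelbrich (Sigma_star T \<Lambda> \<gamma>) T = norm (transport \<Lambda> \<gamma> ** psd_sqrt T - psd_sqrt T)"
  unfolding Sigma_star_transport by (rule gelbrich_transport[OF psd_transport[OF vl \<gamma>] T])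

lemma gelbrich_Sigma_star_in_frame:
  fixes T :: "real^'n^'n"
  assumes vl: "eigenframe \<Lambda> v l" and \<gamma>: "lambda_max (- \<Lambda>) < \<gamma>" "0 \<le> \<gamma>" and T: "psd T"
  shows "(gelbrich (Sigma_star T \<Lambda> \<gamma>) T)\<^sup>2 = (\<Sum>i\<in>UNIV. (l i / (\<gamma> + l i))\<^sup>2 * (v i \<bullet> (T *v v i)))"
proof -
  let ?B = "mat 1 - transport \<Lambda> \<gamma>" and ?Y = "psd_sqrt T"
  note B = eigenframe_id_minus_transport[OF vl \<gamma>(1)]
  have "symm ?B" unfolding eq_diag_in_frame[OF B] by (rule symm_diag_in_frame)
  have "gelbrich (Sigma_star T \<Lambda> \<gamma>) T = norm (?B ** ?Y)"
    unfolding gelbrich_Sigma_star[OF assms] matrix_sub_rdistrib by (simp add: norm_minus_commute)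
  then have "(gelbrich (Sigma_star T \<Lambda> \<gamma>) T)\<^sup>2 = (?B ** ?Y) \<bullet> (?B ** ?Y)"
    by (simp add: power2_norm_eq_inner)
  also have "\<dots> = ?B \<bullet> (?B ** T)"
    unfolding inner_mult_right by (simp add: psd_sqrt_mult_transpose[OF T] flip: matrix_mul_assoc)
  also have "\<dots> = (?B ** ?B) \<bullet> T" by (simp add: inner_symm_mult[OF \<open>symm ?B\<close>])
  also have "eigenframe (?B ** ?B) v (\<lambda>i. (l i / (\<gamma> + l i))\<^sup>2)"
    using eigenframeD[OF B] by (simp add: eigenframe_def power2_eq_square matrix_vector_mult_scaleR
        flip: matrix_vector_mul_assoc)
  note inner_in_frame[OF this, of T]
  finally show ?thesis .
qed

section \<open>Lagrangian duality\<close>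

text \<open>Completing the square. The left side is the Lagrangian of the problem in the variable \<open>X\<close>; it
  is quadratic in \<open>X\<close> with Hessian given by \<open>M = \<gamma> I + \<Lambda>\<close>, and its critical point solves
  \<open>M ** X = \<gamma> Y\<close> with \<open>Y = psd_sqrt T\<close>.\<close>

lemma lagrangian_identity:
  fixes T \<Lambda> X :: "real^'n^'n"
  assumes vl: "eigenframe \<Lambda> v l" and \<gamma>: "lambda_max (- \<Lambda>) < \<gamma>" and T: "psd T"
  defines "Z \<equiv> X - transport \<Lambda> \<gamma> ** psd_sqrt T"
  shows "frob_inner \<Lambda> (X ** transpose X) + \<gamma> * ((norm (X - psd_sqrt T))\<^sup>2 - \<epsilon>\<^sup>2) =
    gamma_objective T \<epsilon> \<Lambda> \<gamma> + Z \<bullet> ((\<gamma> *\<^sub>R mat 1 + \<Lambda>) ** Z)"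
proof -
  let ?Y = "psd_sqrt T" and ?M = "\<gamma> *\<^sub>R mat 1 + \<Lambda>"
  let ?V = "transport \<Lambda> \<gamma> ** ?Y"
  have "symm ?M" unfolding eq_diag_in_frame[OF eigenframe_shift[OF vl]] by (rule symm_diag_in_frame)
  have MV: "?M ** ?V = \<gamma> *\<^sub>R ?Y"
    using resolvent[OF vl \<gamma>]
    by (simp add: transport_def matrix_mul_assoc matrix_scalar_ac flip: scalar_matrix_assoc)
  have MX: "?M ** X = \<gamma> *\<^sub>R X + \<Lambda> ** X"
    by (simp add: matrix_add_rdistrib flip: scalar_matrix_assoc)
  have "?V \<bullet> (?M ** X) = (\<gamma> *\<^sub>R ?Y) \<bullet> X"
    using inner_symm_mult[OF \<open>symm ?M\<close>, of ?V X] by (simp add: MV)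
  then have Z_eq: "Z \<bullet> (?M ** Z) = X \<bullet> (\<gamma> *\<^sub>R X + \<Lambda> ** X) - 2 * \<gamma> * (X \<bullet> ?Y) + \<gamma> * (?V \<bullet> ?Y)"
    unfolding Z_def matrix_sub_ldistrib MV MX
    by (simp add: inner_diff_left inner_diff_right inner_add_right inner_commute algebra_simps)
  have cost: "frob_inner \<Lambda> (X ** transpose X) = X \<bullet> (\<Lambda> ** X)"
    by (simp add: frob_inner_eq_inner inner_commute flip: inner_mult_right)
  have penalty: "frob_inner (mat 1 - transport \<Lambda> \<gamma>) T = ?Y \<bullet> ?Y - ?V \<bullet> ?Y"
  proof -
    have "frob_inner (mat 1 - transport \<Lambda> \<gamma>) T = ((mat 1 - transport \<Lambda> \<gamma>) ** ?Y) \<bullet> ?Y"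
      unfolding inner_mult_right by (simp add: frob_inner_eq_inner psd_sqrt_mult_transpose[OF T])
    then show ?thesis by (simp add: matrix_sub_rdistrib inner_diff_left)
  qed
  have distance: "(norm (X - ?Y))\<^sup>2 = X \<bullet> X - 2 * (X \<bullet> ?Y) + ?Y \<bullet> ?Y"
    by (simp add: power2_norm_eq_inner inner_diff_left inner_diff_right inner_commute)
  show ?thesis
    unfolding gamma_objective_def transport_def[symmetric] Z_eq cost penalty distance
    by (simp add: inner_add_right algebra_simps)
qed

text \<open>Complementary slackness. For feasible \<open>S = X X\<^sup>T\<close> the penalty in the Lagrangian is nonpositive,
  so \<open>\<langle>\<Lambda>, S\<rangle>\<close> exceeds the dual value by at least \<open>Z \<bullet> (M ** Z)\<close>, and equality forces \<open>Z = 0\<close>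
  because \<open>M\<close> is positive definite. Here \<open>X\<close> must be a square root of \<open>S\<close> that attains the
  distance, since only then the penalty has the right sign.\<close>

lemma oracle_argmin_eqI:
  fixes T \<Lambda> :: "real^'n^'n"
  assumes \<Lambda>: "symm \<Lambda>" and T: "psd T" and \<epsilon>: "0 < \<epsilon>"
    and \<gamma>: "lambda_max (- \<Lambda>) < \<gamma>" "0 \<le> \<gamma>"
    and ball: "gelbrich (Sigma_star T \<Lambda> \<gamma>) T \<le> \<epsilon>"
    and slack: "\<gamma> * ((gelbrich (Sigma_star T \<Lambda> \<gamma>) T)\<^sup>2 - \<epsilon>\<^sup>2) = 0"
  shows "oracle_argmin T \<epsilon> \<Lambda> = {Sigma_star T \<Lambda> \<gamma>}"
proof -
  obtain v l where vl: "eigenframe \<Lambda> v l" using spectral_theorem[OF \<Lambda>] .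
  let ?Y = "psd_sqrt T" and ?M = "\<gamma> *\<^sub>R mat 1 + \<Lambda>" and ?S = "Sigma_star T \<Lambda> \<gamma>"
  let ?V = "transport \<Lambda> \<gamma> ** ?Y"
  have "symm (transport \<Lambda> \<gamma>)" by (rule psd_symm[OF psd_transport[OF vl \<gamma>]])
  then have "?V ** transpose ?V = transport \<Lambda> \<gamma> ** (?Y ** transpose ?Y) ** transport \<Lambda> \<gamma>"
    by (simp add: matrix_transpose_mul symm_def matrix_mul_assoc)
  then have VV: "?V ** transpose ?V = ?S"
    by (simp add: psd_sqrt_mult_transpose[OF T] Sigma_star_transport)
  have S_ball: "?S \<in> gelbrich_ball T \<epsilon>"
    using ball psd_gram[of ?V] by (simp add: gelbrich_ball_def VV)
  have S_val: "frob_inner \<Lambda> ?S = gamma_objective T \<epsilon> \<Lambda> \<gamma>"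
    using lagrangian_identity[OF vl \<gamma>(1) T, of ?V \<epsilon>]
    by (simp add: VV slack[unfolded gelbrich_Sigma_star[OF vl \<gamma> T]] del: mult_eq_0_iff)
  have opt: "frob_inner \<Lambda> ?S \<le> frob_inner \<Lambda> S \<and> (frob_inner \<Lambda> S \<le> frob_inner \<Lambda> ?S \<longrightarrow> S = ?S)"
    if "S \<in> gelbrich_ball T \<epsilon>" for S
  proof -
    obtain X where X: "S = X ** transpose X" "norm (X - ?Y) \<le> \<epsilon>"
      using \<open>S \<in> gelbrich_ball T \<epsilon>\<close> unfolding gelbrich_ball_eq[OF T]
      by (auto simp: dist_norm norm_minus_commute)
    define Z where "Z = X - ?V"
    have "(\<gamma> - lambda_max (- \<Lambda>)) * (x \<bullet> x) \<le> x \<bullet> (?M *v x)" for x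
    proof -
      have "symm (- \<Lambda>)" using \<Lambda> symm_diff[of 0 \<Lambda>] by (simp add: symm_def transpose_def vec_eq_iff)
      from quad_le_lambda_max[OF this, of x] show ?thesis
        using matrix_vector_mult_diff_rdistrib[of 0 \<Lambda> x]
        by (simp add: matrix_vector_mult_add_rdistrib inner_add_right algebra_simps
            flip: scaleR_matrix_vector_assoc)
    qed
    then have pos: "(\<gamma> - lambda_max (- \<Lambda>)) * (Z \<bullet> Z) \<le> Z \<bullet> (?M ** Z)" by (rule inner_mult_ge)
    have Z0: "0 \<le> (\<gamma> - lambda_max (- \<Lambda>)) * (Z \<bullet> Z)" using \<gamma> by simp
    have "\<gamma> * ((norm (X - ?Y))\<^sup>2 - \<epsilon>\<^sup>2) \<le> 0"
      using X(2) \<gamma>(2) by (intro mult_nonneg_nonpos) (auto intro: power_mono)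
    then have le: "frob_inner \<Lambda> ?S + Z \<bullet> (?M ** Z) \<le> frob_inner \<Lambda> S"
      using lagrangian_identity[OF vl \<gamma>(1) T, of X \<epsilon>] unfolding X(1) S_val Z_def by linarith
    have "S = ?S" if "frob_inner \<Lambda> S \<le> frob_inner \<Lambda> ?S"
    proof -
      have "(\<gamma> - lambda_max (- \<Lambda>)) * (Z \<bullet> Z) = 0" using le pos Z0 that by linarith
      then have "X = ?V" using \<gamma>(1) by (simp add: Z_def)
      then show ?thesis using X(1) VV by simp
    qed
    then show ?thesis using le pos Z0 by linarith
  qed
  show ?thesis
    unfolding oracle_argmin_def is_arg_min_def using S_ball opt by (auto simp: not_less)
qed

section \<open>The scalar dual problem\<close>

text \<open>Each term \<open>\<gamma> l / (\<gamma> + l)\<close> has derivative \<open>(l / (\<gamma> + l))\<^sup>2\<close>, which is the corresponding term of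
  the squared Gelbrich distance of the candidate optimizer from \<open>T\<close>. The formula is valid on the
  open ray beyond \<open>lambda_max (- \<Lambda>)\<close>, so the derivative is two-sided even at \<open>\<gamma> = 0\<close>.\<close>

lemma objective_has_derivative:
  fixes T \<Lambda> :: "real^'n^'n"
  assumes \<Lambda>: "symm \<Lambda>" and T: "psd T" and \<gamma>: "lambda_max (- \<Lambda>) < \<gamma>" "0 \<le> \<gamma>"
  shows "(gamma_objective T \<epsilon> \<Lambda> has_real_derivative
    (gelbrich (Sigma_star T \<Lambda> \<gamma>) T)\<^sup>2 - \<epsilon>\<^sup>2) (at \<gamma>)"
proof -
  obtain v l where vl: "eigenframe \<Lambda> v l" using spectral_theorem[OF \<Lambda>] .
  define t where "t i = v i \<bullet> (T *v v i)" for i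
  have d: "((\<lambda>\<gamma>. \<gamma> * l i / (\<gamma> + l i) * t i) has_real_derivative (l i / (\<gamma> + l i))\<^sup>2 * t i) (at \<gamma>)" for i
    using shift_pos[OF vl \<gamma>(1), of i]
    by (auto intro!: derivative_eq_intros simp: power2_eq_square field_simps)
  have "((\<lambda>\<gamma>. (\<Sum>i\<in>UNIV. \<gamma> * l i / (\<gamma> + l i) * t i) - \<gamma> * \<epsilon>\<^sup>2) has_real_derivative
    (\<Sum>i\<in>UNIV. (l i / (\<gamma> + l i))\<^sup>2 * t i) - \<epsilon>\<^sup>2) (at \<gamma>)"
    by (rule derivative_eq_intros d refl | simp)+
  then show ?thesis
    unfolding gelbrich_Sigma_star_in_frame[OF vl \<gamma> T] t_def
    by (rule has_field_derivative_transform_within_open[where S = "{lambda_max (- \<Lambda>)<..}"])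
       (use \<gamma> objective_in_frame[OF vl] in auto)
qed

lemma gelbrich_Sigma_star_nonneg:
  fixes T \<Lambda> :: "real^'n^'n"
  assumes "symm \<Lambda>" "psd T" "lambda_max (- \<Lambda>) < \<gamma>" "0 \<le> \<gamma>"
  shows "0 \<le> gelbrich (Sigma_star T \<Lambda> \<gamma>) T"
  using spectral_theorem[OF assms(1)] gelbrich_Sigma_star[OF _ assms(3,4,2)] by (metis norm_ge_zero)

lemma
  fixes T \<Lambda> :: "real^'n^'n"
  assumes \<Lambda>: "symm \<Lambda>" and T: "psd T"
    and \<gamma>: "lambda_max (- \<Lambda>) < \<gamma>" "0 \<le> \<gamma>" "\<gamma> \<le> \<gamma>'"
  shows gelbrich_Sigma_star_antimono:
      "(gelbrich (Sigma_star T \<Lambda> \<gamma>') T)\<^sup>2 \<le> (gelbrich (Sigma_star T \<Lambda> \<gamma>) T)\<^sup>2"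
    and gelbrich_Sigma_star_strict_antimono:
      "\<gamma> < \<gamma>' \<Longrightarrow> 0 < (gelbrich (Sigma_star T \<Lambda> \<gamma>') T)\<^sup>2 \<Longrightarrow>
       (gelbrich (Sigma_star T \<Lambda> \<gamma>') T)\<^sup>2 < (gelbrich (Sigma_star T \<Lambda> \<gamma>) T)\<^sup>2"
proof -
  obtain v l where vl: "eigenframe \<Lambda> v l" using spectral_theorem[OF \<Lambda>] .
  define t where "t i = v i \<bullet> (T *v v i)" for i
  have t: "0 \<le> t i" for i using T by (simp add: psd_def t_def)
  have \<gamma>': "lambda_max (- \<Lambda>) < \<gamma>'" "0 \<le> \<gamma>'" using \<gamma> by auto
  have G: "(gelbrich (Sigma_star T \<Lambda> \<gamma>) T)\<^sup>2 = (\<Sum>i\<in>UNIV. (l i / (\<gamma> + l i))\<^sup>2 * t i)"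
    "(gelbrich (Sigma_star T \<Lambda> \<gamma>') T)\<^sup>2 = (\<Sum>i\<in>UNIV. (l i / (\<gamma>' + l i))\<^sup>2 * t i)"
    by (simp_all add: gelbrich_Sigma_star_in_frame[OF vl] \<gamma> \<gamma>' T t_def)
  have pos: "0 < \<gamma> + l i" for i using shift_pos[OF vl \<gamma>(1)] .
  have sq: "(l i / (\<gamma>' + l i))\<^sup>2 \<le> (l i / (\<gamma> + l i))\<^sup>2" for i
    using pos[of i] \<gamma>(3) unfolding power_divide by (intro divide_left_mono power_mono) auto
  show "(gelbrich (Sigma_star T \<Lambda> \<gamma>') T)\<^sup>2 \<le> (gelbrich (Sigma_star T \<Lambda> \<gamma>) T)\<^sup>2"
    unfolding G by (intro sum_mono mult_right_mono sq t)
  assume lt: "\<gamma> < \<gamma>'" and nz: "0 < (gelbrich (Sigma_star T \<Lambda> \<gamma>') T)\<^sup>2"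
  obtain i where i: "l i \<noteq> 0" "t i \<noteq> 0"
  proof (rule ccontr)
    assume "\<not> thesis"
    then have z: "(l i / (\<gamma>' + l i))\<^sup>2 * t i = 0" for i using that by fastforce
    show False using nz unfolding G z by simp
  qed
  have "(l i / (\<gamma>' + l i))\<^sup>2 < (l i / (\<gamma> + l i))\<^sup>2"
    using pos[of i] lt i(1) unfolding power_divide
    by (intro divide_strict_left_mono power_strict_mono) auto
  then have "(l i / (\<gamma>' + l i))\<^sup>2 * t i < (l i / (\<gamma> + l i))\<^sup>2 * t i"
    using i(2) t[of i] by (intro mult_strict_right_mono) auto
  then show "(gelbrich (Sigma_star T \<Lambda> \<gamma>') T)\<^sup>2 < (gelbrich (Sigma_star T \<Lambda> \<gamma>) T)\<^sup>2"
    unfolding G by (intro sum_strict_mono_ex1) (auto intro: mult_right_mono sq t)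
qed

abbreviation gamma_bound :: "real^'n^'n \<Rightarrow> real \<Rightarrow> real^'n^'n \<Rightarrow> real" where
  "gamma_bound T \<epsilon> \<Lambda> \<equiv> 1 / \<epsilon> * norm \<Lambda> * (2 * sqrt (lambda_max T) + \<epsilon>)"

text \<open>This is where the upper end of the feasible interval comes from: beyond it,
  \<open>\<gamma> + l i \<ge> 2 * s * norm \<Lambda> / \<epsilon>\<close> with \<open>s = sqrt (lambda_max T)\<close>, while
  \<open>\<Sum> (l i)\<^sup>2 * t i \<le> (s * norm \<Lambda>)\<^sup>2\<close>. The squared distance is thus at most \<open>\<epsilon>\<^sup>2 / 4\<close>;
  if \<open>s * norm \<Lambda> = 0\<close>, all its terms vanish.\<close>

lemma gelbrich_beyond_gamma_bound:
  fixes T \<Lambda> :: "real^'n^'n"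
  assumes \<Lambda>: "symm \<Lambda>" and T: "psd T" and \<epsilon>: "0 < \<epsilon>"
    and \<gamma>: "lambda_max (- \<Lambda>) < \<gamma>" "0 \<le> \<gamma>" "gamma_bound T \<epsilon> \<Lambda> \<le> \<gamma>"
  shows "(gelbrich (Sigma_star T \<Lambda> \<gamma>) T)\<^sup>2 < \<epsilon>\<^sup>2"
proof -
  obtain v l where vl: "eigenframe \<Lambda> v l" using spectral_theorem[OF \<Lambda>] .
  note v = eigenframeD[OF vl]
  define t where "t i = v i \<bullet> (T *v v i)" for i
  define L where "L = norm \<Lambda>"
  define s where "s = sqrt (lambda_max T)"
  define r where "r = 2 * s * L / \<epsilon>"
  have s: "0 \<le> s" "s\<^sup>2 = lambda_max T" using lambda_max_psd_nonneg[OF T] by (auto simp: s_def)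
  have vv: "v i \<bullet> v i = 1" for i using v(1) by (simp add: orthonormal_on_def)
  have t: "0 \<le> t i" for i using T by (simp add: psd_def t_def)
  have t_le: "t i \<le> s\<^sup>2" for i
    using quad_le_lambda_max[OF psd_symm[OF T], of "v i"] by (simp add: t_def s vv)
  have L2: "L\<^sup>2 = (\<Sum>i\<in>UNIV. (l i)\<^sup>2)"
    unfolding L_def power2_norm_eq_inner inner_in_frame[OF vl] by (simp add: v(2) vv power2_eq_square)
  have l_le: "\<bar>l i\<bar> \<le> L" for i
  proof (rule power2_le_imp_le)
    show "\<bar>l i\<bar>\<^sup>2 \<le> L\<^sup>2" unfolding L2 power2_abs by (rule member_le_sum) auto
  qed (simp add: L_def)
  have num: "(\<Sum>i\<in>UNIV. (l i)\<^sup>2 * t i) \<le> (s * L)\<^sup>2"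
  proof -
    have "(\<Sum>i\<in>UNIV. (l i)\<^sup>2 * t i) \<le> (\<Sum>i\<in>UNIV. (l i)\<^sup>2 * s\<^sup>2)"
      by (intro sum_mono mult_left_mono t_le) auto
    then show ?thesis by (simp add: L2 power_mult_distrib mult.commute sum_distrib_left)
  qed
  have G: "(gelbrich (Sigma_star T \<Lambda> \<gamma>) T)\<^sup>2 = (\<Sum>i\<in>UNIV. (l i)\<^sup>2 * t i / (\<gamma> + l i)\<^sup>2)"
    by (simp add: gelbrich_Sigma_star_in_frame[OF vl \<gamma>(1,2) T] t_def power_divide)
  show ?thesis
  proof (cases "s * L = 0")
    case True
    then have "(\<Sum>i\<in>UNIV. (l i)\<^sup>2 * t i) = 0"
      using num t by (intro antisym sum_nonneg) auto
    then have "\<forall>i\<in>UNIV. (l i)\<^sup>2 * t i = 0"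
      by (subst (asm) sum_nonneg_eq_0_iff) (auto simp: t)
    then have "(l i)\<^sup>2 * t i / (\<gamma> + l i)\<^sup>2 = 0" for i by simp
    then show ?thesis unfolding G using \<epsilon> by (simp only: sum.neutral_const zero_less_power)
  next
    case False
    then have sL: "0 < s * L" using s(1) by (simp add: L_def less_le)
    then have r: "0 < r" using \<epsilon> unfolding r_def by (intro divide_pos_pos) (simp_all add: mult.assoc)
    have "gamma_bound T \<epsilon> \<Lambda> = r + L" using \<epsilon> by (simp add: r_def L_def s_def field_simps)
    then have "r \<le> \<gamma> + l i" for i using \<gamma>(3) l_le[of i] by linarith
    then have "r\<^sup>2 \<le> (\<gamma> + l i)\<^sup>2" for i using r by (intro power_mono) auto
    then have "(\<Sum>i\<in>UNIV. (l i)\<^sup>2 * t i / (\<gamma> + l i)\<^sup>2) \<le> (\<Sum>i\<in>UNIV. (l i)\<^sup>2 * t i / r\<^sup>2)"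
      using r by (intro sum_mono frac_le) (auto simp: t)
    also have "\<dots> \<le> (s * L)\<^sup>2 / r\<^sup>2"
      using num by (simp add: divide_right_mono flip: sum_divide_distrib)
    also have "\<dots> = \<epsilon>\<^sup>2 / 4"
    proof -
      have "s \<noteq> 0" "L \<noteq> 0" using sL by auto
      then show ?thesis using \<epsilon> by (simp add: r_def power_divide power_mult_distrib)
    qed
    also have "\<dots> < \<epsilon>\<^sup>2" using \<epsilon> by simp
    finally show ?thesis unfolding G .
  qed
qed

lemma gamma_feasible_iff:
  "\<gamma> \<in> gamma_feasible T \<epsilon> \<Lambda> \<longleftrightarrow> 0 \<le> \<gamma> \<and> lambda_max (- \<Lambda>) < \<gamma> \<and> \<gamma> \<le> gamma_bound T \<epsilon> \<Lambda>"
  by (simp add: gamma_feasible_def)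

lemma gamma_solution_iff:
  "gamma_solution T \<epsilon> \<Lambda> \<gamma> \<longleftrightarrow> \<gamma> \<in> gamma_feasible T \<epsilon> \<Lambda> \<and>
    (\<forall>\<gamma>'\<in>gamma_feasible T \<epsilon> \<Lambda>. gamma_objective T \<epsilon> \<Lambda> \<gamma>' \<le> gamma_objective T \<epsilon> \<Lambda> \<gamma>)"
  by (auto simp: gamma_solution_def is_arg_max_def not_less)

lemma is_interval_gamma_feasible: "is_interval (gamma_feasible T \<epsilon> \<Lambda>)"
  unfolding is_interval_1
proof (intro ballI allI impI)
  fix a b x
  assume "a \<in> gamma_feasible T \<epsilon> \<Lambda>" "b \<in> gamma_feasible T \<epsilon> \<Lambda>" "a \<le> x \<and> x \<le> b"
  then show "x \<in> gamma_feasible T \<epsilon> \<Lambda>" unfolding gamma_feasible_iff by linarith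
qed

lemma concave_gamma_objective:
  fixes T \<Lambda> :: "real^'n^'n"
  assumes \<Lambda>: "symm \<Lambda>" and T: "psd T"
  shows "concave_on (gamma_feasible T \<epsilon> \<Lambda>) (gamma_objective T \<epsilon> \<Lambda>)"
  unfolding concave_on_def
proof (rule convex_on_realI)
  show "connected (gamma_feasible T \<epsilon> \<Lambda>)"
    by (rule is_interval_connected[OF is_interval_gamma_feasible])
next
  fix x assume x: "x \<in> gamma_feasible T \<epsilon> \<Lambda>"
  show "((\<lambda>x. - gamma_objective T \<epsilon> \<Lambda> x) has_real_derivative
      - ((gelbrich (Sigma_star T \<Lambda> x) T)\<^sup>2 - \<epsilon>\<^sup>2)) (at x)"
    using x by (intro DERIV_minus objective_has_derivative \<Lambda> T) (auto simp: gamma_feasible_iff)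
next
  fix x y assume "x \<in> gamma_feasible T \<epsilon> \<Lambda>" "y \<in> gamma_feasible T \<epsilon> \<Lambda>" "x \<le> y"
  then show "- ((gelbrich (Sigma_star T \<Lambda> x) T)\<^sup>2 - \<epsilon>\<^sup>2) \<le> - ((gelbrich (Sigma_star T \<Lambda> y) T)\<^sup>2 - \<epsilon>\<^sup>2)"
    using gelbrich_Sigma_star_antimono[OF \<Lambda> T, of x y] by (auto simp: gamma_feasible_iff)
qed

text \<open>The one-sided first-order conditions. A positive derivative is excluded by moving right, which
  is possible because the derivative is negative at the upper end; a negative one is excluded by
  moving left, which is possible unless \<open>\<gamma> = 0\<close>, as the bound \<open>lambda_max (- \<Lambda>)\<close> is strict.\<close>

lemma gamma_solution_complementarity:
  fixes T \<Lambda> :: "real^'n^'n"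
  assumes \<Lambda>: "symm \<Lambda>" and T: "psd T" and \<epsilon>: "0 < \<epsilon>" and sol: "gamma_solution T \<epsilon> \<Lambda> \<gamma>"
  shows "(gelbrich (Sigma_star T \<Lambda> \<gamma>) T)\<^sup>2 \<le> \<epsilon>\<^sup>2"
    and "0 < \<gamma> \<Longrightarrow> (gelbrich (Sigma_star T \<Lambda> \<gamma>) T)\<^sup>2 = \<epsilon>\<^sup>2"
proof -
  let ?G = "(gelbrich (Sigma_star T \<Lambda> \<gamma>) T)\<^sup>2"
  have feas: "0 \<le> \<gamma>" "lambda_max (- \<Lambda>) < \<gamma>" "\<gamma> \<le> gamma_bound T \<epsilon> \<Lambda>"
    and max: "\<And>\<gamma>'. \<gamma>' \<in> gamma_feasible T \<epsilon> \<Lambda> \<Longrightarrow> gamma_objective T \<epsilon> \<Lambda> \<gamma>' \<le> gamma_objective T \<epsilon> \<Lambda> \<gamma>"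
    using sol by (auto simp: gamma_solution_iff gamma_feasible_iff)
  note deriv = objective_has_derivative[OF \<Lambda> T feas(2,1), of \<epsilon>]
  show le: "?G \<le> \<epsilon>\<^sup>2"
  proof (rule ccontr)
    assume "\<not> ?G \<le> \<epsilon>\<^sup>2"
    then have gt: "0 < ?G - \<epsilon>\<^sup>2" by simp
    then have "\<gamma> < gamma_bound T \<epsilon> \<Lambda>"
      using gelbrich_beyond_gamma_bound[OF \<Lambda> T \<epsilon> feas(2,1)] by linarith
    moreover obtain d where d: "0 < d"
      "\<And>h. 0 < h \<Longrightarrow> h < d \<Longrightarrow> gamma_objective T \<epsilon> \<Lambda> \<gamma> < gamma_objective T \<epsilon> \<Lambda> (\<gamma> + h)"
      using DERIV_pos_inc_right[OF deriv gt] by blast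
    define h where "h = min (d / 2) (gamma_bound T \<epsilon> \<Lambda> - \<gamma>)"
    have "h \<le> d / 2" "h \<le> gamma_bound T \<epsilon> \<Lambda> - \<gamma>" "0 < h"
      using d(1) calculation(1) unfolding h_def by (auto simp only: min.cobounded1 min.cobounded2 min_less_iff_conj)
    then have "0 < h" "h < d" "h \<le> gamma_bound T \<epsilon> \<Lambda> - \<gamma>" using d(1) by auto
    then show False
      using d(2)[of h] max[of "\<gamma> + h"] feas unfolding gamma_feasible_iff by linarith
  qed
  assume pos: "0 < \<gamma>"
  have "\<not> ?G < \<epsilon>\<^sup>2"
  proof
    assume "?G < \<epsilon>\<^sup>2"
    then have lt: "?G - \<epsilon>\<^sup>2 < 0" by simp
    obtain d where d: "0 < d"
      "\<And>h. 0 < h \<Longrightarrow> h < d \<Longrightarrow> gamma_objective T \<epsilon> \<Lambda> \<gamma> < gamma_objective T \<epsilon> \<Lambda> (\<gamma> - h)"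
      using DERIV_neg_dec_left[OF deriv lt] by blast
    define m where "m = max 0 (lambda_max (- \<Lambda>))"
    have m: "0 \<le> m" "lambda_max (- \<Lambda>) \<le> m" "m < \<gamma>" using pos feas(2) by (auto simp: m_def)
    define h where "h = min (d / 2) ((\<gamma> - m) / 2)"
    have h: "h \<le> (\<gamma> - m) / 2" unfolding h_def by (rule min.cobounded2)
    have "2 * h \<le> \<gamma> - m" using h by simp
    then have "h < \<gamma>" using m(1,3) by linarith
    moreover have "lambda_max (- \<Lambda>) < \<gamma> - h" using \<open>2 * h \<le> \<gamma> - m\<close> m(2,3) by linarith
    moreover have "0 < h" "h < d" using d(1) m by (auto simp: h_def)
    ultimately show False
      using d(2)[of h] max[of "\<gamma> - h"] feas unfolding gamma_feasible_iff by linarith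
  qed
  then show "?G = \<epsilon>\<^sup>2" using le by linarith
qed

text \<open>The larger of two solutions \<open>x < y\<close> is positive, hence a zero of the derivative. There the distance is
  \<open>\<epsilon> > 0\<close>, so the derivative is strictly decreasing and would be positive at the solution \<open>x\<close>.\<close>

lemma gamma_solution_unique:
  fixes T \<Lambda> :: "real^'n^'n"
  assumes \<Lambda>: "symm \<Lambda>" and T: "psd T" and \<epsilon>: "0 < \<epsilon>"
    and sol: "gamma_solution T \<epsilon> \<Lambda> \<gamma>" "gamma_solution T \<epsilon> \<Lambda> \<gamma>'"
  shows "\<gamma> = \<gamma>'"
proof -
  have no: "\<not> x < y" if s: "gamma_solution T \<epsilon> \<Lambda> x" "gamma_solution T \<epsilon> \<Lambda> y" for x y
  proof
    assume xy: "x < y"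
    have x: "lambda_max (- \<Lambda>) < x" "0 \<le> x" using s(1) by (auto simp: gamma_solution_iff gamma_feasible_iff)
    have "(gelbrich (Sigma_star T \<Lambda> y) T)\<^sup>2 = \<epsilon>\<^sup>2"
      using gamma_solution_complementarity(2)[OF \<Lambda> T \<epsilon> s(2)] x xy by simp
    then show False
      using gelbrich_Sigma_star_strict_antimono[OF \<Lambda> T x _ xy] xy \<epsilon>
        gamma_solution_complementarity(1)[OF \<Lambda> T \<epsilon> s(1)] by simp
  qed
  show ?thesis using no[OF sol] no[OF sol(2,1)] by simp
qed

text \<open>The feasible interval may be open on the left. If no point to the left of \<open>\<gamma>\<close> beats \<open>\<gamma>\<close>, it may be
  cut off at \<open>\<gamma>\<close>, and the rest is compact.\<close>

lemma gamma_solution_existsI: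
  fixes T \<Lambda> :: "real^'n^'n"
  assumes \<Lambda>: "symm \<Lambda>" and T: "psd T"
    and \<gamma>: "\<gamma> \<in> gamma_feasible T \<epsilon> \<Lambda>"
    and left: "\<And>\<gamma>'. \<gamma>' \<in> gamma_feasible T \<epsilon> \<Lambda> \<Longrightarrow> \<gamma>' < \<gamma> \<Longrightarrow>
      gamma_objective T \<epsilon> \<Lambda> \<gamma>' \<le> gamma_objective T \<epsilon> \<Lambda> \<gamma>"
  shows "\<exists>\<gamma>s. gamma_solution T \<epsilon> \<Lambda> \<gamma>s"
proof -
  let ?I = "{\<gamma>..gamma_bound T \<epsilon> \<Lambda>}"
  have I: "?I \<subseteq> gamma_feasible T \<epsilon> \<Lambda>" using \<gamma> by (auto simp: gamma_feasible_iff)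
  have "continuous_on ?I (gamma_objective T \<epsilon> \<Lambda>)"
  proof (intro continuous_at_imp_continuous_on ballI)
    fix x assume "x \<in> ?I"
    then have "x \<in> gamma_feasible T \<epsilon> \<Lambda>" using I by blast
    then have "lambda_max (- \<Lambda>) < x" "0 \<le> x" by (simp_all add: gamma_feasible_iff)
    from objective_has_derivative[OF \<Lambda> T this]
    show "isCont (gamma_objective T \<epsilon> \<Lambda>) x" by (rule DERIV_isCont)
  qed
  moreover have "\<gamma> \<in> ?I" using \<gamma> by (auto simp: gamma_feasible_iff)
  ultimately obtain s where s: "s \<in> ?I" "\<And>y. y \<in> ?I \<Longrightarrow> gamma_objective T \<epsilon> \<Lambda> y \<le> gamma_objective T \<epsilon> \<Lambda> s"
    using continuous_attains_sup[of ?I "gamma_objective T \<epsilon> \<Lambda>"] by auto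
  have "gamma_objective T \<epsilon> \<Lambda> y \<le> gamma_objective T \<epsilon> \<Lambda> s" if y: "y \<in> gamma_feasible T \<epsilon> \<Lambda>" for y
  proof (cases "y < \<gamma>")
    case True
    then show ?thesis using left[OF y] s(2)[OF \<open>\<gamma> \<in> ?I\<close>] by linarith
  next
    case False
    then show ?thesis using y by (intro s(2)) (auto simp: gamma_feasible_iff)
  qed
  moreover have "s \<in> gamma_feasible T \<epsilon> \<Lambda>" using s(1) I by blast
  ultimately show ?thesis unfolding gamma_solution_iff by blast
qed

lemma gamma_solution_exists_iff:
  fixes T \<Lambda> :: "real^'n^'n"
  assumes \<Lambda>: "symm \<Lambda>" and T: "psd T" and \<epsilon>: "0 < \<epsilon>"
  shows "(\<exists>\<gamma>s. gamma_solution T \<epsilon> \<Lambda> \<gamma>s) \<longleftrightarrow> lambda_max (- \<Lambda>) < 0 \<or>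
    (\<exists>\<gamma>>lambda_max (- \<Lambda>). \<epsilon> \<le> gelbrich (Sigma_star T \<Lambda> \<gamma>) T)"
proof
  assume "\<exists>\<gamma>s. gamma_solution T \<epsilon> \<Lambda> \<gamma>s"
  then obtain s where s: "gamma_solution T \<epsilon> \<Lambda> s" by blast
  then have feas: "0 \<le> s" "lambda_max (- \<Lambda>) < s" by (auto simp: gamma_solution_iff gamma_feasible_iff)
  show "lambda_max (- \<Lambda>) < 0 \<or> (\<exists>\<gamma>>lambda_max (- \<Lambda>). \<epsilon> \<le> gelbrich (Sigma_star T \<Lambda> \<gamma>) T)"
  proof (cases "lambda_max (- \<Lambda>) < 0")
    case False
    then have "(gelbrich (Sigma_star T \<Lambda> s) T)\<^sup>2 = \<epsilon>\<^sup>2"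
      using gamma_solution_complementarity(2)[OF \<Lambda> T \<epsilon> s] feas by simp
    then have "\<epsilon> \<le> gelbrich (Sigma_star T \<Lambda> s) T"
      by (intro power2_le_imp_le[OF _ gelbrich_Sigma_star_nonneg[OF \<Lambda> T feas(2,1)]]) simp
    then show ?thesis using feas by blast
  qed simp
next
  assume r: "lambda_max (- \<Lambda>) < 0 \<or> (\<exists>\<gamma>>lambda_max (- \<Lambda>). \<epsilon> \<le> gelbrich (Sigma_star T \<Lambda> \<gamma>) T)"
  show "\<exists>\<gamma>s. gamma_solution T \<epsilon> \<Lambda> \<gamma>s"
  proof (cases "lambda_max (- \<Lambda>) < 0")
    case True
    have "0 \<le> gamma_bound T \<epsilon> \<Lambda>" using \<epsilon> lambda_max_psd_nonneg[OF T] by simp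
    with True have "0 \<in> gamma_feasible T \<epsilon> \<Lambda>" by (simp only: gamma_feasible_iff order_refl)
    then show ?thesis
      by (rule gamma_solution_existsI[OF \<Lambda> T]) (simp add: gamma_feasible_iff)
  next
    case False
    then obtain g where g: "lambda_max (- \<Lambda>) < g" "\<epsilon> \<le> gelbrich (Sigma_star T \<Lambda> g) T"
      using r by blast
    then have g0: "0 \<le> g" using False by simp
    have G: "\<epsilon>\<^sup>2 \<le> (gelbrich (Sigma_star T \<Lambda> g) T)\<^sup>2" using g(2) \<epsilon> by (intro power_mono) auto
    then have "g < gamma_bound T \<epsilon> \<Lambda>"
      using gelbrich_beyond_gamma_bound[OF \<Lambda> T \<epsilon> g(1) g0] by linarith
    then have feas: "g \<in> gamma_feasible T \<epsilon> \<Lambda>" using g(1) g0 by (simp add: gamma_feasible_iff)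
    show ?thesis
    proof (rule gamma_solution_existsI[OF \<Lambda> T feas])
      fix x assume x: "x \<in> gamma_feasible T \<epsilon> \<Lambda>" "x < g"
      show "gamma_objective T \<epsilon> \<Lambda> x \<le> gamma_objective T \<epsilon> \<Lambda> g"
      proof (rule DERIV_nonneg_imp_nondecreasing[where f = "gamma_objective T \<epsilon> \<Lambda>"])
        fix y assume y: "x \<le> y" "y \<le> g"
        then have y': "lambda_max (- \<Lambda>) < y" "0 \<le> y" using x(1) by (auto simp: gamma_feasible_iff)
        have "0 \<le> (gelbrich (Sigma_star T \<Lambda> y) T)\<^sup>2 - \<epsilon>\<^sup>2"
          using gelbrich_Sigma_star_antimono[OF \<Lambda> T y' y(2)] G by linarith
        then show "\<exists>z. (gamma_objective T \<epsilon> \<Lambda> has_real_derivative z) (at y) \<and> 0 \<le> z"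
          using objective_has_derivative[OF \<Lambda> T y'] by blast
      qed (use x in simp)
    qed
  qed
qed

text \<open>As \<open>\<gamma>\<close> decreases to \<open>m = lambda_max (- \<Lambda>) > 0\<close>, a term \<open>(l i / (\<gamma> + l i))\<^sup>2 * t i\<close> with
  \<open>l i = - m\<close> and \<open>t i > 0\<close> grows without bound. Such an \<open>i\<close> exists, since otherwise \<open>T\<close> would
  vanish on the eigenvector \<open>w\<close>.\<close>

lemma gelbrich_Sigma_star_large:
  fixes T \<Lambda> :: "real^'n^'n"
  assumes \<Lambda>: "symm \<Lambda>" and T: "psd T" and \<epsilon>: "0 < \<epsilon>" and pos: "0 < lambda_max (- \<Lambda>)"
    and w: "(- \<Lambda>) *v w = lambda_max (- \<Lambda>) *\<^sub>R w" "0 < w \<bullet> (T *v w)"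
  shows "\<exists>\<gamma>>lambda_max (- \<Lambda>). \<epsilon> \<le> gelbrich (Sigma_star T \<Lambda> \<gamma>) T"
proof -
  obtain v l where vl: "eigenframe \<Lambda> v l" using spectral_theorem[OF \<Lambda>] .
  note v = eigenframeD[OF vl]
  define m where "m = lambda_max (- \<Lambda>)"
  define t where "t i = v i \<bullet> (T *v v i)" for i
  have t: "0 \<le> t i" for i using T by (simp add: psd_def t_def)
  have \<Lambda>w: "\<Lambda> *v w = - m *\<^sub>R w"
    using w(1) matrix_vector_mult_diff_rdistrib[of 0 \<Lambda> w] by (simp add: m_def)
  obtain i where i: "v i \<bullet> w \<noteq> 0" "T *v v i \<noteq> 0"
  proof (rule ccontr)
    assume "\<not> thesis"
    then have z: "(v i \<bullet> w) *\<^sub>R (T *v v i) = 0" for i using that by fastforce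
    have "T *v w = T *v (\<Sum>i\<in>UNIV. (v i \<bullet> w) *\<^sub>R v i)"
      using frame_expansion[OF v(1), of w] by (rule arg_cong)
    also have "\<dots> = (\<Sum>i\<in>UNIV. (v i \<bullet> w) *\<^sub>R (T *v v i))"
      by (simp add: linear_sum[OF matrix_vector_mul_linear] matrix_vector_mult_scaleR)
    also have "\<dots> = 0" unfolding z by simp
    finally show False using w(2) by simp
  qed
  have "l i * (v i \<bullet> w) = (\<Lambda> *v v i) \<bullet> w" by (simp add: v(2))
  also have "\<dots> = v i \<bullet> (\<Lambda> *v w)" by (rule symm_inner[OF \<Lambda>, symmetric])
  also have "\<dots> = - m * (v i \<bullet> w)" by (simp add: \<Lambda>w)
  finally have "(l i + m) * (v i \<bullet> w) = 0" by (simp add: algebra_simps)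
  then have l: "l i = - m" using i(1) by simp
  have ti: "0 < t i" using psd_kernel[OF T, of "v i"] i(2) t[of i] by (auto simp: t_def less_le)
  \<comment> \<open>With this \<open>\<delta>\<close> the single term belonging to \<open>i\<close> already equals \<open>\<epsilon>\<^sup>2\<close>.\<close>
  define \<delta> where "\<delta> = m * sqrt (t i) / \<epsilon>"
  have \<delta>: "0 < \<delta>" using pos ti \<epsilon> by (simp add: \<delta>_def m_def)
  then have g: "lambda_max (- \<Lambda>) < m + \<delta>" "0 \<le> m + \<delta>" using pos by (simp_all add: m_def)
  have "\<epsilon>\<^sup>2 = (m / \<delta>)\<^sup>2 * t i"
    using pos \<epsilon> ti by (simp add: \<delta>_def m_def power_divide power_mult_distrib)
  also have "\<dots> = (l i / (m + \<delta> + l i))\<^sup>2 * t i" by (simp add: l power_divide)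
  also have "\<dots> \<le> (\<Sum>i\<in>UNIV. (l i / (m + \<delta> + l i))\<^sup>2 * t i)"
    by (rule member_le_sum) (auto simp: t)
  also have "\<dots> = (gelbrich (Sigma_star T \<Lambda> (m + \<delta>)) T)\<^sup>2"
    by (simp add: gelbrich_Sigma_star_in_frame[OF vl g T] t_def)
  finally have "\<epsilon> \<le> gelbrich (Sigma_star T \<Lambda> (m + \<delta>)) T"
    by (rule power2_le_imp_le) (rule gelbrich_Sigma_star_nonneg[OF \<Lambda> T g])
  then show ?thesis using g(1) by blast
qed

lemma oracle_argmin_gamma_solution:
  fixes T \<Lambda> :: "real^'n^'n"
  assumes \<Lambda>: "symm \<Lambda>" and T: "psd T" and \<epsilon>: "0 < \<epsilon>" and sol: "gamma_solution T \<epsilon> \<Lambda> \<gamma>"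
  shows "oracle_argmin T \<epsilon> \<Lambda> = {Sigma_star T \<Lambda> \<gamma>}"
proof (rule oracle_argmin_eqI[OF \<Lambda> T \<epsilon>])
  note compl = gamma_solution_complementarity[OF \<Lambda> T \<epsilon> sol]
  show feas: "lambda_max (- \<Lambda>) < \<gamma>" "0 \<le> \<gamma>"
    using sol by (auto simp: gamma_solution_iff gamma_feasible_iff)
  show "gelbrich (Sigma_star T \<Lambda> \<gamma>) T \<le> \<epsilon>"
    by (rule power2_le_imp_le[OF compl(1)]) (use \<epsilon> in simp)
  show "\<gamma> * ((gelbrich (Sigma_star T \<Lambda> \<gamma>) T)\<^sup>2 - \<epsilon>\<^sup>2) = 0"
    using compl(2) feas(2) by (cases "\<gamma> = 0") auto
qed

section \<open>Minimal linear values and maximal norm on a compact set\<close>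

context
  fixes B :: "(real^'n^'n) set"
  assumes compact: "compact B" and ne: "B \<noteq> {}"
begin

lemma support_attained:
  obtains S where "S \<in> B" "(INF S\<in>B. frob_inner \<Lambda> S) = frob_inner \<Lambda> S"
    "\<And>S'. S' \<in> B \<Longrightarrow> frob_inner \<Lambda> S \<le> frob_inner \<Lambda> S'"
proof -
  have "continuous_on B (frob_inner \<Lambda>)"
    unfolding frob_inner_eq_inner by (intro continuous_intros)
  then obtain S where S: "S \<in> B" "\<And>S'. S' \<in> B \<Longrightarrow> frob_inner \<Lambda> S \<le> frob_inner \<Lambda> S'"
    using continuous_attains_inf[OF compact ne, of "frob_inner \<Lambda>"] by blast
  have "(INF S\<in>B. frob_inner \<Lambda> S) = frob_inner \<Lambda> S"
    by (rule cInf_eq_minimum) (use S in auto)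
  then show thesis using S that by blast
qed

lemma max_norm_attained:
  obtains S where "S \<in> B" "(SUP S\<in>B. norm S) = norm S" "\<And>S'. S' \<in> B \<Longrightarrow> norm S' \<le> norm S"
proof -
  obtain S where S: "S \<in> B" "\<And>S'. S' \<in> B \<Longrightarrow> norm S' \<le> norm S"
    using continuous_attains_sup[OF compact ne, of norm] by (auto intro: continuous_intros)
  have "(SUP S\<in>B. norm S) = norm S" by (rule cSup_eq_maximum) (use S in auto)
  then show thesis using S that by blast
qed

lemma support_lipschitz:
  "(SUP S\<in>B. norm S)-lipschitz_on A (\<lambda>\<Lambda>. INF S\<in>B. frob_inner \<Lambda> S)"
proof -
  obtain R where R: "R \<in> B" "(SUP S\<in>B. norm S) = norm R" "\<And>S'. S' \<in> B \<Longrightarrow> norm S' \<le> norm R"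
    using max_norm_attained by blast
  have one: "(INF S\<in>B. frob_inner x S) - (INF S\<in>B. frob_inner y S) \<le> norm R * norm (x - y)" for x y
  proof -
    obtain Sx where x: "(INF S\<in>B. frob_inner x S) = frob_inner x Sx"
        "\<And>S'. S' \<in> B \<Longrightarrow> frob_inner x Sx \<le> frob_inner x S'"
      using support_attained[of x] by metis
    obtain Sy where y: "Sy \<in> B" "(INF S\<in>B. frob_inner y S) = frob_inner y Sy"
      using support_attained[of y] by metis
    have "frob_inner x Sx - frob_inner y Sy \<le> (x - y) \<bullet> Sy"
      using x(2)[OF y(1)] by (simp add: frob_inner_eq_inner inner_diff_left)
    also have "\<dots> \<le> norm (x - y) * norm Sy" by (rule norm_cauchy_schwarz)
    also have "\<dots> \<le> norm (x - y) * norm R" by (intro mult_left_mono R(3) y(1)) simp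
    finally show ?thesis by (simp add: x y mult.commute)
  qed
  show ?thesis
    unfolding R(2)
  proof (rule lipschitz_onI)
    fix x y
    show "dist (INF S\<in>B. frob_inner x S) (INF S\<in>B. frob_inner y S) \<le> norm R * dist x y"
      using one[of x y] one[of y x] by (simp add: dist_norm norm_minus_commute abs_le_iff)
  qed simp
qed

text \<open>With \<open>R\<close> an element of largest norm, compare the values at \<open>0\<close> and \<open>- R\<close>: they are \<open>0\<close> and at most
  \<open>- (norm R)\<^sup>2\<close>, at distance \<open>norm R\<close>. Symmetry of \<open>R\<close> puts \<open>- R\<close> into the domain.\<close>

lemma max_norm_le_lipschitz:
  assumes symm: "\<And>S. S \<in> B \<Longrightarrow> symm S"
    and K: "K-lipschitz_on {\<Lambda>. symm \<Lambda>} (\<lambda>\<Lambda>. INF S\<in>B. frob_inner \<Lambda> S)"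
  shows "(SUP S\<in>B. norm S) \<le> K"
proof -
  let ?g = "\<lambda>\<Lambda>. INF S\<in>B. frob_inner \<Lambda> S"
  obtain R where R: "R \<in> B" "(SUP S\<in>B. norm S) = norm R" "\<And>S'. S' \<in> B \<Longrightarrow> norm S' \<le> norm R"
    using max_norm_attained by blast
  obtain S0 where "S0 \<in> B" "?g 0 = frob_inner 0 S0" using support_attained[of 0] by metis
  then have g0: "?g 0 = 0" by (simp add: frob_inner_eq_inner)
  obtain S where S: "S \<in> B" "?g (- R) = frob_inner (- R) S" "\<And>S'. S' \<in> B \<Longrightarrow> frob_inner (- R) S \<le> frob_inner (- R) S'"
    using support_attained[of "- R"] by metis
  have "?g (- R) \<le> - (norm R)\<^sup>2"
    using S(2) S(3)[OF R(1)] by (simp add: frob_inner_eq_inner power2_norm_eq_inner)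
  moreover have "dist (?g (- R)) (?g 0) \<le> K * dist (- R) 0"
  proof (rule lipschitz_onD[OF K])
    show "- R \<in> {\<Lambda>. symm \<Lambda>}" using symm_diff[of 0 R] symm[OF R(1)]
      by (simp add: symm_def transpose_def vec_eq_iff)
  qed (simp add: symm_def transpose_def vec_eq_iff)
  ultimately have "norm R * norm R \<le> K * norm R"
    unfolding g0 by (simp add: dist_norm power2_eq_square)
  moreover have "0 \<le> K" using K by (rule lipschitz_on_nonneg)
  ultimately show ?thesis unfolding R(2) by (cases "R = 0") auto
qed

end

theorem proposition3p4:
  fixes \<Sigma>h :: "real^'n^'n" and \<epsilon> :: real
  assumes "psd \<Sigma>h" and "0 < \<epsilon>"
  shows
    "(\<forall>\<Lambda>. symm \<Lambda> \<longrightarrow>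
        concave_on (gamma_feasible \<Sigma>h \<epsilon> \<Lambda>) (gamma_objective \<Sigma>h \<epsilon> \<Lambda>) \<and>
        (\<forall>\<gamma>s. gamma_solution \<Sigma>h \<epsilon> \<Lambda> \<gamma>s \<longrightarrow>
           (\<forall>\<gamma>. gamma_solution \<Sigma>h \<epsilon> \<Lambda> \<gamma> \<longrightarrow> \<gamma> = \<gamma>s) \<and>
           oracle_argmin \<Sigma>h \<epsilon> \<Lambda> = {Sigma_star \<Sigma>h \<Lambda> \<gamma>s}) \<and>
        ((\<exists>\<gamma>s. gamma_solution \<Sigma>h \<epsilon> \<Lambda> \<gamma>s) \<longleftrightarrow>
           lambda_max (- \<Lambda>) < 0 \<or>
           (\<exists>\<gamma>>lambda_max (- \<Lambda>). \<epsilon> \<le> gelbrich (Sigma_star \<Sigma>h \<Lambda> \<gamma>) \<Sigma>h)) \<and>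
        (0 < lambda_max (- \<Lambda>) \<and>
           (\<exists>v. (- \<Lambda>) *v v = lambda_max (- \<Lambda>) *\<^sub>R v \<and> 0 < v \<bullet> (\<Sigma>h *v v)) \<longrightarrow>
         (\<exists>\<gamma>s. gamma_solution \<Sigma>h \<epsilon> \<Lambda> \<gamma>s)))
     \<and>
     (\<forall>\<Lambda>. symm \<Lambda> \<longrightarrow>
        (\<exists>S\<in>gelbrich_ball \<Sigma>h \<epsilon>. frob_inner \<Lambda> S = dual_fun \<Sigma>h \<epsilon> \<Lambda> \<and>
           (\<forall>S'\<in>gelbrich_ball \<Sigma>h \<epsilon>. frob_inner \<Lambda> S \<le> frob_inner \<Lambda> S'))) \<and>
     (\<exists>S\<in>gelbrich_ball \<Sigma>h \<epsilon>. norm S = dual_lip \<Sigma>h \<epsilon> \<and>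
        (\<forall>S'\<in>gelbrich_ball \<Sigma>h \<epsilon>. norm S' \<le> norm S)) \<and>
     (dual_lip \<Sigma>h \<epsilon>)-lipschitz_on {\<Lambda>. symm \<Lambda>} (dual_fun \<Sigma>h \<epsilon>) \<and>
     (\<forall>K. K-lipschitz_on {\<Lambda>. symm \<Lambda>} (dual_fun \<Sigma>h \<epsilon>) \<longrightarrow> dual_lip \<Sigma>h \<epsilon> \<le> K) \<and>
     dual_lip \<Sigma>h \<epsilon> \<le> (2 * sqrt (lambda_max \<Sigma>h) + \<epsilon>) * \<epsilon> + norm \<Sigma>h"
proof -
  let ?B = "gelbrich_ball \<Sigma>h \<epsilon>"
  note T = \<open>psd \<Sigma>h\<close> and \<epsilon> = \<open>0 < \<epsilon>\<close>
  have B: "compact ?B" "?B \<noteq> {}"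
    using compact_gelbrich_ball[OF T] center_in_gelbrich_ball[OF T, of \<epsilon>] \<epsilon> by auto
  have closed_form: "concave_on (gamma_feasible \<Sigma>h \<epsilon> \<Lambda>) (gamma_objective \<Sigma>h \<epsilon> \<Lambda>) \<and>
        (\<forall>\<gamma>s. gamma_solution \<Sigma>h \<epsilon> \<Lambda> \<gamma>s \<longrightarrow>
           (\<forall>\<gamma>. gamma_solution \<Sigma>h \<epsilon> \<Lambda> \<gamma> \<longrightarrow> \<gamma> = \<gamma>s) \<and>
           oracle_argmin \<Sigma>h \<epsilon> \<Lambda> = {Sigma_star \<Sigma>h \<Lambda> \<gamma>s}) \<and>
        ((\<exists>\<gamma>s. gamma_solution \<Sigma>h \<epsilon> \<Lambda> \<gamma>s) \<longleftrightarrow>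
           lambda_max (- \<Lambda>) < 0 \<or>
           (\<exists>\<gamma>>lambda_max (- \<Lambda>). \<epsilon> \<le> gelbrich (Sigma_star \<Sigma>h \<Lambda> \<gamma>) \<Sigma>h)) \<and>
        (0 < lambda_max (- \<Lambda>) \<and>
           (\<exists>v. (- \<Lambda>) *v v = lambda_max (- \<Lambda>) *\<^sub>R v \<and> 0 < v \<bullet> (\<Sigma>h *v v)) \<longrightarrow>
         (\<exists>\<gamma>s. gamma_solution \<Sigma>h \<epsilon> \<Lambda> \<gamma>s))" if \<Lambda>: "symm \<Lambda>" for \<Lambda>
  proof (intro conjI allI impI)
    show "concave_on (gamma_feasible \<Sigma>h \<epsilon> \<Lambda>) (gamma_objective \<Sigma>h \<epsilon> \<Lambda>)"
      by (rule concave_gamma_objective[OF \<Lambda> T])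
    show "\<gamma> = \<gamma>s" if "gamma_solution \<Sigma>h \<epsilon> \<Lambda> \<gamma>s" "gamma_solution \<Sigma>h \<epsilon> \<Lambda> \<gamma>" for \<gamma> \<gamma>s
      by (rule gamma_solution_unique[OF \<Lambda> T \<epsilon> that(2,1)])
    show "oracle_argmin \<Sigma>h \<epsilon> \<Lambda> = {Sigma_star \<Sigma>h \<Lambda> \<gamma>s}" if "gamma_solution \<Sigma>h \<epsilon> \<Lambda> \<gamma>s" for \<gamma>s
      by (rule oracle_argmin_gamma_solution[OF \<Lambda> T \<epsilon> that])
    show ex: "(\<exists>\<gamma>s. gamma_solution \<Sigma>h \<epsilon> \<Lambda> \<gamma>s) \<longleftrightarrow> lambda_max (- \<Lambda>) < 0 \<or>
       (\<exists>\<gamma>>lambda_max (- \<Lambda>). \<epsilon> \<le> gelbrich (Sigma_star \<Sigma>h \<Lambda> \<gamma>) \<Sigma>h)"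
      by (rule gamma_solution_exists_iff[OF \<Lambda> T \<epsilon>])
    show "\<exists>\<gamma>s. gamma_solution \<Sigma>h \<epsilon> \<Lambda> \<gamma>s"
      if "0 < lambda_max (- \<Lambda>) \<and>
        (\<exists>v. (- \<Lambda>) *v v = lambda_max (- \<Lambda>) *\<^sub>R v \<and> 0 < v \<bullet> (\<Sigma>h *v v))"
      unfolding ex using that gelbrich_Sigma_star_large[OF \<Lambda> T \<epsilon>] by blast
  qed
  have attained: "\<exists>S\<in>?B. frob_inner \<Lambda> S = dual_fun \<Sigma>h \<epsilon> \<Lambda> \<and>
      (\<forall>S'\<in>?B. frob_inner \<Lambda> S \<le> frob_inner \<Lambda> S')" for \<Lambda>
    unfolding dual_fun_def by (rule support_attained[OF B, of \<Lambda>]) force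
  obtain R where R: "R \<in> ?B" "dual_lip \<Sigma>h \<epsilon> = norm R" "\<And>S'. S' \<in> ?B \<Longrightarrow> norm S' \<le> norm R"
    unfolding dual_lip_def using max_norm_attained[OF B] by blast
  have lip: "(dual_lip \<Sigma>h \<epsilon>)-lipschitz_on {\<Lambda>. symm \<Lambda>} (dual_fun \<Sigma>h \<epsilon>)"
    using support_lipschitz[OF B] unfolding dual_lip_def dual_fun_def[abs_def] .
  have least: "dual_lip \<Sigma>h \<epsilon> \<le> K" if "K-lipschitz_on {\<Lambda>. symm \<Lambda>} (dual_fun \<Sigma>h \<epsilon>)" for K
    using that unfolding dual_lip_def dual_fun_def[abs_def]
    by (rule max_norm_le_lipschitz[OF B, rotated]) (simp add: gelbrich_ball_def psd_symm)
  have bound: "dual_lip \<Sigma>h \<epsilon> \<le> (2 * sqrt (lambda_max \<Sigma>h) + \<epsilon>) * \<epsilon> + norm \<Sigma>h"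
    unfolding R(2) by (rule norm_gelbrich_ball_le[OF T R(1)])
  show ?thesis
  proof (intro conjI)
    show "\<exists>S\<in>?B. norm S = dual_lip \<Sigma>h \<epsilon> \<and> (\<forall>S'\<in>?B. norm S' \<le> norm S)" using R by auto
  qed (use closed_form attained lip least bound in \<open>blast+\<close>)
qed

end
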